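(* Let $s\ge1$, $N\in\mathbb N$, and let $\alpha_1,\dots,\alpha_{s+1},\beta\in\mathbb R$ satisfy $\alpha_1-1>\beta>0$, $\alpha_i>1$ for $2\le i\le s+1$. For $j\in\{1,\dots,s\}$ define the difference operator in the discrete variables $n_1,\dots,n_s$ $$\widetilde{\mathfrak L}_j^{\mathbf n}=\widetilde{\mathfrak L}_j^{\mathbf n}(n_1,\dots,n_s;\alpha_1,\dots,\alpha_{s+1},\beta,N)=\sum_{\nu\in\{-1,0,1\}^j}\widetilde D_\nu(n_1,\dots,n_s)T_{+,n_{s-j+1}}^{\nu_j}T_{+,n_{s-j+2}}^{\nu_{j-1}-\nu_j}\cdots T_{+,n_s}^{\nu_1-\nu_2}$$ $$+\Big(\tfrac{\alpha_{[1;s+1]}+\alpha_{[s-j+2;s+1]}}2+N-(-1)^{N+N_{s-j}}\big(N_{s-j}+\tfrac{\alpha_{[2;s-j+1]}+\beta}2\big)(\beta-\alpha_1+1)\Big),$$ with $\widetilde D_\nu$ as in the context. Then $\widetilde{\mathfrak L}_1^{\mathbf n},\dots,\widetilde{\mathfrak L}_s^{\mathbf n}$ mutually commute, and the renormalized multivariate Bannai--Ito polynomials are common eigenfunctions: for all $\mathbf n\in\mathbb N^s$, all integers $x_1,\dots,x_s$ and all $j\in\{1,\dots,s\}$, $$\widetilde{\mathfrak L}_j^{\mathbf n}\,\widehat B_{\mathbf n}(\mathbf x;\boldsymbol\alpha,\beta,N)=\widetilde\kappa_j\,\widehat B_{\mathbf n}(\mathbf x;\boldsymbol\alpha,\beta,N),$$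 $$\widetilde\kappa_j=\frac{\alpha_{[1;s+1]}+\alpha_{[s-j+2;s+1]}}2+N-(-1)^{N+x_{s-j+1}}\Big(x_{s-j+1}+\frac{\alpha_{[1;s-j+1]}}2\Big).$$
   Context: Notation: $\alpha_{[i;j]}=\alpha_i+\dots+\alpha_j$ (zero if $i>j$); $(a)_m=\prod_{t=0}^{m-1}(a+t)$; $m=2m_e+m_p$, $m_p\in\{0,1\}$; $N_k=n_1+\dots+n_k$; $T_{+,n_i}f(n_1,\dots,n_s)=f(n_1,\dots,n_i+1,\dots,n_s)$. Terms in which a shifted index $n_i$ becomes negative have vanishing coefficient and are omitted. Coefficients: $\widetilde D_\nu=\prod_{\ell=0}^j\widetilde E_\ell^{(\nu_\ell,\nu_{\ell+1})}/\prod_{\ell=1}^j\tilde e_\ell^{\nu_\ell}$ with $\nu_0=\nu_{j+1}=0$, where $\widetilde E_0^{(0,0)}=-\frac12((2N+\alpha_{[1;s+1]})+(-1)^{N+N_s}(2N_s+\alpha_{[2;s+1]}+\beta)(\alpha_1-\beta-1))$, $\widetilde E_0^{(0,1)}=-\frac12((2N+2N_s+2\alpha_{[2;s+1]}+\alpha_1+\beta+1)+(-1)^{N-N_s}(\beta-\alpha_1+1))$, $\widetilde E_0^{(0,-1)}=-\frac12((2N-2N_s+\alpha_1-\beta+1)-(-1)^{N-N_s}(\beta-\alpha_1+1))$, and for $1\le\ell\le j$, with $p=s-\ell+1$, $\epsilon=(-1)^{n_p}$, $u=\alpha_{[2;p+1]}+\beta$, $v=\alpha_{[2;p]}+\beta$: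 $\widetilde E_\ell^{(0,0)}=(1-\alpha_{p+1})-\epsilon(2N_p+u)(2N_{p-1}+v)$, $\widetilde E_\ell^{(0,1)}=-(2N_{p-1}+u)+\epsilon(2N_p+u)$, $\widetilde E_\ell^{(1,0)}=-(2N_p+u+\alpha_{p+1})+\epsilon(2N_{p-1}+v)$, $\widetilde E_\ell^{(1,1)}=-(4N_{p-1}+2n_p+2u+1)-\epsilon$, $\widetilde E_\ell^{(-1,0)}=(2N_p+v)-\epsilon(2N_{p-1}+v)$, $\widetilde E_\ell^{(-1,1)}=2n_p-1+\epsilon$, $\widetilde E_\ell^{(0,-1)}=(2N_{p-1}+v-\alpha_{p+1})-\epsilon(2N_p+u)$, $\widetilde E_\ell^{(1,-1)}=-(2n_p+2\alpha_{p+1}+1)+\epsilon$, $\widetilde E_\ell^{(-1,-1)}=(4N_{p-1}+2n_p+2v-1)-\epsilon$, $\tilde e_\ell^0=-(2N_p+u+1)(2N_p+u-1)$, $\tilde e_\ell^1=-2(2N_p+u+1)$, $\tilde e_\ell^{-1}=2(2N_p+u-1)$. Univariate Bannai--Ito polynomials $B_m(x;\rho_1,\rho_2,r_1,r_2)$: $B_{-1}=0$, $B_0=1$, $xB_m=B_{m+1}+(\rho_1-A_m-C_m)B_m+A_{m-1}C_mB_{m-1}$ with $A_m=\frac{(m+2\rho_1-2r_1+m_p(2\rho_2-2r_2)+1)(m+2\rho_1-2r_2+m_p(2r_2+2\rho_2)+1)}{4(m+\rho_1+\rho_2-r_1-r_2+1)}$, $C_m=-\frac{(m+m_p(2\rho_2-2r_2))(m-2r_1-2r_2+m_p(2r_2+2\rho_2))}{4(m+\rho_1+\rho_2-r_1-r_2)}$.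 Multivariate: with $x_{s+1}=N$, $B_{\mathbf n}(\mathbf x;\boldsymbol\alpha,\beta,N)=\prod_{k=1}^sB_{n_k}\big(\frac{(-1)^{N_{k-1}+x_k}}2(x_k+\frac{\alpha_{[1;k]}}2)-\frac14;\rho_1^{(k)},\rho_2^{(k)},r_1^{(k)},r_2^{(k)}\big)$, where $X_k=\frac{(-1)^{N_{k-1}+x_{k+1}}}2(x_{k+1}+\frac{\alpha_{[1;k+1]}}2)$, $\rho_1^{(k)}=\frac{N_{k-1}}2+\frac{\alpha_{[1;k]}-1}4$, $\rho_2^{(k)}=X_k+\frac{\alpha_{k+1}-1}4$, $r_1^{(k)}=X_k-\frac{\alpha_{k+1}-1}4$, $r_2^{(k)}=-\frac{N_{k-1}}2+\frac{\alpha_1-\alpha_{[2;k]}-1}4-\frac\beta2$. Renormalized: $\widehat B_{\mathbf n}=k_{\mathbf n}B_{\mathbf n}$, with $$k_{\mathbf n}=\frac{(-1)^{N_sN+\sum_{k=2}^sn_kN_{k-1}}\prod_{k=1}^s\eta_k\theta_k}{\prod_{\ell=0}^{N_s-1}\big(-(2\ell+2N+\alpha_1+2\alpha_{[2;s+1]}+\beta+1)+(-1)^{N+\ell}(\alpha_1-\beta-1)\big)},$$ $\eta_k=\prod_{\ell=0}^{(n_k)_e+(n_k)_p-1}\frac{2\ell+2N_{k-1}+\alpha_{[2;k]}+\beta+1}{2\ell+\alpha_{k+1}}$, $\theta_k=\frac{(-8)^{n_k}\left(N_{k-1}+\frac{\alpha_{[2;k+1]}+\beta+1}2\right)_{n_k}}{\prod_{0\le\ell<n_k,\,\ell\text{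 even}}(\ell+2N_{k-1}+\alpha_{[2;k]}+\beta+1)\prod_{0\le\ell<n_k,\,\ell\text{ odd}}(\ell+2N_{k-1}+\alpha_{[2;k+1]}+\beta)}$. *)

theory Defs
  imports Complex_Main
begin

text \<open>
  Multi-indices \<open>n = (n\<^sub>1, \<dots>, n\<^sub>s)\<close>, points \<open>x = (x\<^sub>1, \<dots>, x\<^sub>s)\<close> and parameters
  \<open>\<alpha> = (\<alpha>\<^sub>1, \<dots>, \<alpha>\<^sub>s\<^sub>+\<^sub>1)\<close> are functions on \<open>nat\<close> of which only the values at \<open>1, \<dots>, s\<close>
  (respectively \<open>1, \<dots>, s + 1\<close>) are used.  The value of a multi-index outside \<open>{1..s}\<close>
  neither enters a coefficient nor is changed by the operators below.
\<close>

definition asum :: "(nat \<Rightarrow> real) \<Rightarrow> nat \<Rightarrow> nat \<Rightarrow> real"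
  where "asum \<alpha> i j = (\<Sum>t = i..j. \<alpha> t)"

definition nsum :: "(nat \<Rightarrow> nat) \<Rightarrow> nat \<Rightarrow> nat"
  where "nsum n k = (\<Sum>i = 1..k. n i)"


subsection \<open>The coefficients\<close>

text \<open>
  In the three definitions below, \<open>a\<close> and \<open>b\<close> are the upper indices
  \<open>\<nu>\<^sub>\<ell>\<close> and \<open>\<nu>\<^sub>\<ell>\<^sub>+\<^sub>1\<close>, which only take the values \<open>-1, 0, 1\<close>; the last branch of each
  conditional is the one remaining value (pair of values).
\<close>

definition coeff_E0 :: "nat \<Rightarrow> (nat \<Rightarrow> real) \<Rightarrow> real \<Rightarrow> nat \<Rightarrow> (nat \<Rightarrow> nat) \<Rightarrow> int \<Rightarrow> real"
  where "coeff_E0 s \<alpha> \<beta> N n b =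
    (let Ns = nsum n s in
     if b = 0 then
       - (1/2) * ((2 * real N + asum \<alpha> 1 (s+1))
         + (-1) ^ (N + Ns) * (2 * real Ns + asum \<alpha> 2 (s+1) + \<beta>) * (\<alpha> 1 - \<beta> - 1))
     else if b = 1 then
       - (1/2) * ((2 * real N + 2 * real Ns + 2 * asum \<alpha> 2 (s+1) + \<alpha> 1 + \<beta> + 1)
         + (-1) powi (int N - int Ns) * (\<beta> - \<alpha> 1 + 1))
     else
       - (1/2) * ((2 * real N - 2 * real Ns + \<alpha> 1 - \<beta> + 1)
         - (-1) powi (int N - int Ns) * (\<beta> - \<alpha> 1 + 1)))"

definition coeff_E :: "nat \<Rightarrow> (nat \<Rightarrow> real) \<Rightarrow> real \<Rightarrow> (nat \<Rightarrow> nat) \<Rightarrow> nat \<Rightarrow> int \<Rightarrow> int \<Rightarrow> real"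
  where "coeff_E s \<alpha> \<beta> n l a b =
    (let p = s - l + 1;
         \<epsilon> = (-1) ^ n p;
         u = asum \<alpha> 2 (p+1) + \<beta>;
         v = asum \<alpha> 2 p + \<beta>;
         Np = real (nsum n p);
         Nq = real (nsum n (p-1));
         np = real (n p)
     in
     if (a, b) = (0, 0) then (1 - \<alpha> (p+1)) - \<epsilon> * (2 * Np + u) * (2 * Nq + v)
     else if (a, b) = (0, 1) then - (2 * Nq + u) + \<epsilon> * (2 * Np + u)
     else if (a, b) = (1, 0) then - (2 * Np + u + \<alpha> (p+1)) + \<epsilon> * (2 * Nq + v)
     else if (a, b) = (1, 1) then - (4 * Nq + 2 * np + 2 * u + 1) - \<epsilon>
     else if (a, b) = (-1, 0) then (2 * Np + v) - \<epsilon> * (2 * Nq + v)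
     else if (a, b) = (-1, 1) then 2 * np - 1 + \<epsilon>
     else if (a, b) = (0, -1) then (2 * Nq + v - \<alpha> (p+1)) - \<epsilon> * (2 * Np + u)
     else if (a, b) = (1, -1) then - (2 * np + 2 * \<alpha> (p+1) + 1) + \<epsilon>
     else (4 * Nq + 2 * np + 2 * v - 1) - \<epsilon>)"

definition coeff_e :: "nat \<Rightarrow> (nat \<Rightarrow> real) \<Rightarrow> real \<Rightarrow> (nat \<Rightarrow> nat) \<Rightarrow> nat \<Rightarrow> int \<Rightarrow> real"
  where "coeff_e s \<alpha> \<beta> n l a =
    (let p = s - l + 1;
         u = asum \<alpha> 2 (p+1) + \<beta>;
         Np = real (nsum n p)
     in
     if a = 0 then - (2 * Np + u + 1) * (2 * Np + u - 1)
     else if a = 1 then - 2 * (2 * Np + u + 1)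
     else 2 * (2 * Np + u - 1))"

text \<open>
  The set \<open>{-1, 0, 1}\<^sup>j\<close>, with entries extended by zero outside \<open>{1..j}\<close>, so that
  \<open>\<nu> 0 = \<nu> (j + 1) = 0\<close>.
\<close>

definition step_vectors :: "nat \<Rightarrow> (nat \<Rightarrow> int) set"
  where "step_vectors j =
    {\<nu>. \<forall>l. (l \<in> {1..j} \<longrightarrow> \<nu> l \<in> {-1, 0, 1}) \<and> (l \<notin> {1..j} \<longrightarrow> \<nu> l = 0)}"

lemma finite_step_vectors: "finite (step_vectors j)"
  unfolding step_vectors_def by (rule finite_set_of_finite_funs) auto

definition coeff_D ::
    "nat \<Rightarrow> (nat \<Rightarrow> real) \<Rightarrow> real \<Rightarrow> nat \<Rightarrow> nat \<Rightarrow> (nat \<Rightarrow> int) \<Rightarrow> (nat \<Rightarrow> nat) \<Rightarrow> real"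
  where "coeff_D s \<alpha> \<beta> N j \<nu> n =
    coeff_E0 s \<alpha> \<beta> N n (\<nu> 1) * (\<Prod>l = 1..j. coeff_E s \<alpha> \<beta> n l (\<nu> l) (\<nu> (l+1)))
      / (\<Prod>l = 1..j. coeff_e s \<alpha> \<beta> n l (\<nu> l))"


subsection \<open>The difference operators\<close>

text \<open>
  The product of shifts attached to \<open>\<nu>\<close> adds \<open>\<nu>\<^sub>\<ell> - \<nu>\<^sub>\<ell>\<^sub>+\<^sub>1\<close> to \<open>n\<^sub>s\<^sub>-\<^sub>\<ell>\<^sub>+\<^sub>1\<close> for \<open>1 \<le> \<ell> \<le> j\<close>.
\<close>

definition shifted_index :: "nat \<Rightarrow> nat \<Rightarrow> (nat \<Rightarrow> int) \<Rightarrow> (nat \<Rightarrow> nat) \<Rightarrow> nat \<Rightarrow> int"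
  where "shifted_index s j \<nu> n i =
    (if i \<in> {s-j+1..s} then int (n i) + \<nu> (s-i+1) - \<nu> (s-i+2) else int (n i))"

text \<open>Terms whose shifted index leaves \<open>\<nat>\<^sup>s\<close> are omitted; their coefficients \<open>coeff_D\<close> vanish.\<close>

definition shift_op ::
    "nat \<Rightarrow> nat \<Rightarrow> (nat \<Rightarrow> int) \<Rightarrow> ((nat \<Rightarrow> nat) \<Rightarrow> real) \<Rightarrow> (nat \<Rightarrow> nat) \<Rightarrow> real"
  where "shift_op s j \<nu> f n =
    (if \<forall>i. 0 \<le> shifted_index s j \<nu> n i
     then f (\<lambda>i. nat (shifted_index s j \<nu> n i)) else 0)"

definition BI_op ::
    "nat \<Rightarrow> (nat \<Rightarrow> real) \<Rightarrow> real \<Rightarrow> nat \<Rightarrow> nat \<Rightarrow> ((nat \<Rightarrow> nat) \<Rightarrow> real) \<Rightarrow> (nat \<Rightarrow> nat) \<Rightarrow> real"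
  where "BI_op s \<alpha> \<beta> N j f n =
    (\<Sum>\<nu>\<in>step_vectors j. coeff_D s \<alpha> \<beta> N j \<nu> n * shift_op s j \<nu> f n)
    + ((asum \<alpha> 1 (s+1) + asum \<alpha> (s-j+2) (s+1)) / 2 + real N
       - (-1) ^ (N + nsum n (s-j))
         * (real (nsum n (s-j)) + (asum \<alpha> 2 (s-j+1) + \<beta>) / 2) * (\<beta> - \<alpha> 1 + 1)) * f n"

definition BI_eigenvalue ::
    "nat \<Rightarrow> (nat \<Rightarrow> real) \<Rightarrow> nat \<Rightarrow> (nat \<Rightarrow> int) \<Rightarrow> nat \<Rightarrow> real"
  where "BI_eigenvalue s \<alpha> N x j =
    (asum \<alpha> 1 (s+1) + asum \<alpha> (s-j+2) (s+1)) / 2 + real N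
      - (-1) powi (int N + x (s-j+1)) * (real_of_int (x (s-j+1)) + asum \<alpha> 1 (s-j+1) / 2)"


subsection \<open>Bannai--Ito polynomials\<close>

definition BI_A :: "real \<Rightarrow> real \<Rightarrow> real \<Rightarrow> real \<Rightarrow> nat \<Rightarrow> real"
  where "BI_A \<rho>1 \<rho>2 r1 r2 m =
    (let mp = real (m mod 2) in
     (real m + 2*\<rho>1 - 2*r1 + mp * (2*\<rho>2 - 2*r2) + 1)
       * (real m + 2*\<rho>1 - 2*r2 + mp * (2*r2 + 2*\<rho>2) + 1)
       / (4 * (real m + \<rho>1 + \<rho>2 - r1 - r2 + 1)))"

definition BI_C :: "real \<Rightarrow> real \<Rightarrow> real \<Rightarrow> real \<Rightarrow> nat \<Rightarrow> real"
  where "BI_C \<rho>1 \<rho>2 r1 r2 m =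
    (let mp = real (m mod 2) in
     - ((real m + mp * (2*\<rho>2 - 2*r2)) * (real m - 2*r1 - 2*r2 + mp * (2*r2 + 2*\<rho>2)))
       / (4 * (real m + \<rho>1 + \<rho>2 - r1 - r2)))"

text \<open>
  The three-term recurrence
  \<open>x B\<^sub>m = B\<^sub>m\<^sub>+\<^sub>1 + (\<rho>\<^sub>1 - A\<^sub>m - C\<^sub>m) B\<^sub>m + A\<^sub>m\<^sub>-\<^sub>1 C\<^sub>m B\<^sub>m\<^sub>-\<^sub>1\<close> with \<open>B\<^sub>-\<^sub>1 = 0\<close>, \<open>B\<^sub>0 = 1\<close>,
  solved for \<open>B\<^sub>m\<^sub>+\<^sub>1\<close>.
\<close>

fun BI_poly :: "nat \<Rightarrow> real \<Rightarrow> real \<Rightarrow> real \<Rightarrow> real \<Rightarrow> real \<Rightarrow> real"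
  where
    "BI_poly 0 x \<rho>1 \<rho>2 r1 r2 = 1"
  | "BI_poly (Suc 0) x \<rho>1 \<rho>2 r1 r2 = x - (\<rho>1 - BI_A \<rho>1 \<rho>2 r1 r2 0 - BI_C \<rho>1 \<rho>2 r1 r2 0)"
  | "BI_poly (Suc (Suc m)) x \<rho>1 \<rho>2 r1 r2 =
       (x - (\<rho>1 - BI_A \<rho>1 \<rho>2 r1 r2 (Suc m) - BI_C \<rho>1 \<rho>2 r1 r2 (Suc m)))
         * BI_poly (Suc m) x \<rho>1 \<rho>2 r1 r2
       - BI_A \<rho>1 \<rho>2 r1 r2 m * BI_C \<rho>1 \<rho>2 r1 r2 (Suc m) * BI_poly m x \<rho>1 \<rho>2 r1 r2"

text \<open>
  For \<open>k = s\<close> the factor below uses \<open>x\<^sub>s\<^sub>+\<^sub>1\<close>, which is set to \<open>N\<close> by \<open>y\<close>.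
\<close>

definition multi_BI ::
    "nat \<Rightarrow> (nat \<Rightarrow> real) \<Rightarrow> real \<Rightarrow> nat \<Rightarrow> (nat \<Rightarrow> nat) \<Rightarrow> (nat \<Rightarrow> int) \<Rightarrow> real"
  where "multi_BI s \<alpha> \<beta> N n x =
    (let y = x(s+1 := int N) in
     \<Prod>k = 1..s.
       let M = nsum n (k-1);
           X = (-1) powi (int M + y (k+1)) / 2 * (real_of_int (y (k+1)) + asum \<alpha> 1 (k+1) / 2)
       in BI_poly (n k)
            ((-1) powi (int M + y k) / 2 * (real_of_int (y k) + asum \<alpha> 1 k / 2) - 1/4)
            (real M / 2 + (asum \<alpha> 1 k - 1) / 4)
            (X + (\<alpha> (k+1) - 1) / 4)
            (X - (\<alpha> (k+1) - 1) / 4)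
            (- (real M / 2) + (\<alpha> 1 - asum \<alpha> 2 k - 1) / 4 - \<beta> / 2))"


subsection \<open>Renormalization\<close>

definition norm_eta :: "(nat \<Rightarrow> real) \<Rightarrow> real \<Rightarrow> (nat \<Rightarrow> nat) \<Rightarrow> nat \<Rightarrow> real"
  where "norm_eta \<alpha> \<beta> n k =
    (\<Prod>l<n k div 2 + n k mod 2.
       (2 * real l + 2 * real (nsum n (k-1)) + asum \<alpha> 2 k + \<beta> + 1)
         / (2 * real l + \<alpha> (k+1)))"

definition norm_theta :: "(nat \<Rightarrow> real) \<Rightarrow> real \<Rightarrow> (nat \<Rightarrow> nat) \<Rightarrow> nat \<Rightarrow> real"
  where "norm_theta \<alpha> \<beta> n k =
    (let M = real (nsum n (k-1)) in
     (-8) ^ n k * pochhammer (M + (asum \<alpha> 2 (k+1) + \<beta> + 1) / 2) (n k)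
       / ((\<Prod>l\<in>{l. l < n k \<and> even l}. real l + 2 * M + asum \<alpha> 2 k + \<beta> + 1)
          * (\<Prod>l\<in>{l. l < n k \<and> odd l}. real l + 2 * M + asum \<alpha> 2 (k+1) + \<beta>)))"

definition norm_k ::
    "nat \<Rightarrow> (nat \<Rightarrow> real) \<Rightarrow> real \<Rightarrow> nat \<Rightarrow> (nat \<Rightarrow> nat) \<Rightarrow> real"
  where "norm_k s \<alpha> \<beta> N n =
    (-1) ^ (nsum n s * N + (\<Sum>k = 2..s. n k * nsum n (k-1)))
      * (\<Prod>k = 1..s. norm_eta \<alpha> \<beta> n k * norm_theta \<alpha> \<beta> n k)
      / (\<Prod>l<nsum n s.
           - (2 * real l + 2 * real N + \<alpha> 1 + 2 * asum \<alpha> 2 (s+1) + \<beta> + 1)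
             + (-1) ^ (N + l) * (\<alpha> 1 - \<beta> - 1))"

definition renorm_BI ::
    "nat \<Rightarrow> (nat \<Rightarrow> real) \<Rightarrow> real \<Rightarrow> nat \<Rightarrow> (nat \<Rightarrow> nat) \<Rightarrow> (nat \<Rightarrow> int) \<Rightarrow> real"
  where "renorm_BI s \<alpha> \<beta> N n x = norm_k s \<alpha> \<beta> N n * multi_BI s \<alpha> \<beta> N n x"

end

theory Submission
  imports Defs "HOL-Computational_Algebra.Polynomial"
begin

text \<open>
  The entry \<open>\<nu>\<^sub>\<ell>\<close> of a step vector is the shift of the partial sum \<open>N\<^sub>p\<close>, \<open>p = s - \<ell> + 1\<close>, so the operator is
  a transfer matrix: the factor of index \<open>\<ell>\<close> only sees the shifts of \<open>N\<^sub>p\<close> and \<open>N\<^sub>p\<^sub>-\<^sub>1\<close>.  Summing over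
  \<open>\<nu>\<^sub>1, \<nu>\<^sub>2, \<dots>\<close> in turn reproduces the boundary coefficient \<open>E\<^sub>0\<close> with \<open>(s, N)\<close> replaced by
  \<open>(p - 1, x\<^sub>p)\<close>, times the polynomial factors already absorbed.  The inductive step consists of three
  univariate identities for Bannai--Ito polynomials, one for each shift \<open>b\<close> of \<open>N\<^sub>p\<^sub>-\<^sub>1\<close>: the three-term
  recurrence (\<open>b = 0\<close>) and two contiguity relations (\<open>b = 1\<close> and \<open>b = -1\<close>).  The latter hold because
  both sides satisfy the same three-term recurrence in the degree.

  The operators commute because their commutator annihilates the common eigenfunctions, and these
  are linearly independent as functions of \<open>x\<close>: the \<open>k\<close>-th factor has exact degree \<open>n\<^sub>k\<close> in a variable that
  takes infinitely many values when only \<open>x\<^sub>k\<close> varies.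
\<close>

section \<open>Univariate contiguity relations\<close>

text \<open>
  In the coordinates \<open>t = 2N\<^sub>p + u\<close>, \<open>y = 2N\<^sub>p\<^sub>-\<^sub>1 + v\<close>, \<open>e = (-1)\<close> to the power \<open>n\<^sub>p\<close>, a step \<open>(a, b)\<close> acts by
  \<open>t \<mapsto> t + 2a\<close>, \<open>y \<mapsto> y + 2b\<close>, and \<open>p\<close> enters only through \<open>\<alpha> = \<alpha>\<^sub>p\<^sub>+\<^sub>1\<close>.
\<close>

definition stepE :: "real \<Rightarrow> real \<Rightarrow> real \<Rightarrow> real \<Rightarrow> int \<Rightarrow> int \<Rightarrow> real"
  where "stepE t y \<alpha> e a b =
    (if (a, b) = (0, 0) then 1 - \<alpha> - e * t * y
     else if (a, b) = (0, 1) then - (y + \<alpha>) + e * t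
     else if (a, b) = (1, 0) then - (t + \<alpha>) + e * y
     else if (a, b) = (1, 1) then - (t + y + \<alpha> + 1) - e
     else if (a, b) = (-1, 0) then t - \<alpha> - e * y
     else if (a, b) = (-1, 1) then t - y - \<alpha> - 1 + e
     else if (a, b) = (0, -1) then y - \<alpha> - e * t
     else if (a, b) = (1, -1) then - (t - y + \<alpha> + 1) + e
     else t + y - \<alpha> - 1 - e)"

definition stepe :: "real \<Rightarrow> int \<Rightarrow> real"
  where "stepe t a = (if a = 0 then - (t + 1) * (t - 1) else if a = 1 then - 2 * (t + 1) else 2 * (t - 1))"

text \<open>
  The boundary coefficient \<open>E\<^sub>0\<close>, up to a global sign, after conjugation by the denominator of \<open>k\<^sub>n\<close>.  This
  conjugation makes it a polynomial in \<open>W\<close>, which stands for \<open>x + \<alpha>\<^bsub>[1;p+1]\<^esub>/2\<close> with the sign of the parity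
  of \<open>x = x\<^sub>p\<^sub>+\<^sub>1\<close>; moreover \<open>c = \<beta> - \<alpha>\<^sub>1 + 1\<close> and \<open>\<tau>\<close> is the sign of the parity of \<open>N\<^sub>p\<close>.
\<close>

definition edge :: "real \<Rightarrow> real \<Rightarrow> real \<Rightarrow> real \<Rightarrow> int \<Rightarrow> real"
  where "edge t W c \<tau> a =
    (if a = 0 then - W + \<tau> * t * c / 2 else if a = 1 then 1 / 2
     else ((2 * W - \<tau> * c)\<^sup>2 - (t - 1)\<^sup>2) / 2)"

definition kern :: "real \<Rightarrow> real \<Rightarrow> real \<Rightarrow> real \<Rightarrow> real \<Rightarrow> real \<Rightarrow> real \<Rightarrow> int \<Rightarrow> int \<Rightarrow> real"
  where "kern W c \<alpha> t y e \<tau> a b = edge t W c \<tau> a / stepe t a * stepE t y \<alpha> e a b"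

section \<open>Intertwining of the kernels at neighbouring parameters\<close>

text \<open>The \<open>stepE\<close> coefficients intertwine only up to multiples of a common term
  \<open>z\<close>. The weights, quotients of \<open>edge\<close> by \<open>stepe\<close>, turn
  these defects into the single multiple \<open>d * r * z\<close>.\<close>

lemma combine_two:
  fixes r r1 r2 :: real
  assumes "r * r1 * u - r2 * r * v = d * r"
  shows "r * r1 * (A + u * z) + r2 * r * (B - v * z) = r * r1 * A + r2 * r * B + d * r * z"
  using assms by algebra

lemma combine_three:
  fixes r r1 r2 :: real
  assumes "r1 * s1 * k - r2 * s2 * k - r * r * v = d * r"
  shows "r2 * s2 * (A - k * z) + r1 * s1 * (B + k * z) + r * r * (C - v * z)
    = r2 * s2 * A + r1 * s1 * B + r * r * C + d * r * z"
  using assms by algebra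

context
  fixes W c \<alpha> t y e \<tau> :: real and b :: int
  assumes e: "e = 1 \<or> e = -1" and tau: "\<tau> = 1 \<or> \<tau> = -1" and b: "b = 1 \<or> b = -1"
begin

text \<open>Each identity compares a step with shift 0 of \<open>y\<close> taken before and after a
  step with shift \<open>b\<close>. The sign \<open>e\<close> flips exactly when the degree, which
  moves by \<open>a - b\<close>, moves by an odd amount. Once \<open>e\<close> and \<open>b\<close>
  are fixed these are polynomial identities; every defect contains
  \<open>e * (y + b)\<close>.\<close>

lemma stepE_intertwine:
  shows "stepE t y \<alpha> e 1 0 * stepE (t+2) y \<alpha> (-e) 1 b
      = stepE t y \<alpha> e 1 b * stepE (t+2) (y+2*b) \<alpha> e 1 0"
    and "stepE t y \<alpha> e (-1) 0 * stepE (t-2) y \<alpha> (-e) (-1) b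
      = stepE t y \<alpha> e (-1) b * stepE (t-2) (y+2*b) \<alpha> e (-1) 0"
    and "stepE t y \<alpha> e 1 0 * stepE (t+2) y \<alpha> (-e) 0 b
      = stepE t y \<alpha> e 1 b * stepE (t+2) (y+2*b) \<alpha> e 0 0 + (t+3) * (e * (y+b) * stepE t y \<alpha> e 1 b)"
    and "stepE t y \<alpha> e 0 0 * stepE t y \<alpha> e 1 b
      = stepE t y \<alpha> e 0 b * stepE t (y+2*b) \<alpha> (-e) 1 0 - (t-1) * (e * (y+b) * stepE t y \<alpha> e 1 b)"
    and "stepE t y \<alpha> e (-1) 0 * stepE (t-2) y \<alpha> (-e) 0 b
      = stepE t y \<alpha> e (-1) b * stepE (t-2) (y+2*b) \<alpha> e 0 0 + (t-3) * (e * (y+b) * stepE t y \<alpha> e (-1) b)"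
    and "stepE t y \<alpha> e 0 0 * stepE t y \<alpha> e (-1) b
      = stepE t y \<alpha> e 0 b * stepE t (y+2*b) \<alpha> (-e) (-1) 0 - (t+1) * (e * (y+b) * stepE t y \<alpha> e (-1) b)"
    and "stepE t y \<alpha> e (-1) 0 * stepE (t-2) y \<alpha> (-e) 1 b
      = stepE t y \<alpha> e (-1) b * stepE (t-2) (y+2*b) \<alpha> e 1 0 - 2 * (e * (y+b) * stepE t y \<alpha> e 0 b)"
    and "stepE t y \<alpha> e 1 0 * stepE (t+2) y \<alpha> (-e) (-1) b
      = stepE t y \<alpha> e 1 b * stepE (t+2) (y+2*b) \<alpha> e (-1) 0 + 2 * (e * (y+b) * stepE t y \<alpha> e 0 b)"
    and "stepE t y \<alpha> e 0 0 * stepE t y \<alpha> e 0 b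
      = stepE t y \<alpha> e 0 b * stepE t (y+2*b) \<alpha> (-e) 0 0 - 2 * t * (e * (y+b) * stepE t y \<alpha> e 0 b)"
  using e b by (elim disjE; simp add: stepE_def algebra_simps)+

lemma kern_mult:
  "kern W c \<alpha> t y e \<tau> i j * kern W c \<alpha> t' y' e' \<tau>' i' j' =
     (edge t W c \<tau> i / stepe t i) * (edge t' W c \<tau>' i' / stepe t' i')
       * (stepE t y \<alpha> e i j * stepE t' y' \<alpha> e' i' j')"
  by (simp add: kern_def)

lemma kern_intertwine_up_up:
  shows "kern W c \<alpha> t y e \<tau> 1 0 * kern W c \<alpha> (t+2) y (-e) (-\<tau>) 1 b
    = kern W c \<alpha> t y e \<tau> 1 b * kern W c \<alpha> (t+2) (y+2*b) e (-\<tau>) 1 0"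
  unfolding kern_mult stepE_intertwine by simp

lemma kern_intertwine_down_down:
  shows "kern W c \<alpha> t y e \<tau> (-1) 0 * kern W c \<alpha> (t-2) y (-e) (-\<tau>) (-1) b
    = kern W c \<alpha> t y e \<tau> (-1) b * kern W c \<alpha> (t-2) (y+2*b) e (-\<tau>) (-1) 0"
  unfolding kern_mult stepE_intertwine by simp

text \<open>Collects the two-step paths of total shift 1. As \<open>\<tau> * e\<close> will be
  \<open>\<sigma>\<close>, the remainder is the difference of the eigenvalues
  \<open>edge y Z c \<sigma> 0\<close> and \<open>edge (y + 2 * b) Z c (- \<sigma>) 0\<close>, in
  which \<open>Z\<close> cancels.\<close>

lemma kern_intertwine_up:
  assumes "t + 1 \<noteq> 0" "t - 1 \<noteq> 0" "t + 3 \<noteq> 0"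
  shows "kern W c \<alpha> t y e \<tau> 1 0 * kern W c \<alpha> (t+2) y (-e) (-\<tau>) 0 b
     + kern W c \<alpha> t y e \<tau> 0 0 * kern W c \<alpha> t y e \<tau> 1 b
    = kern W c \<alpha> t y e \<tau> 1 b * kern W c \<alpha> (t+2) (y+2*b) e (-\<tau>) 0 0
     + kern W c \<alpha> t y e \<tau> 0 b * kern W c \<alpha> t (y+2*b) (-e) \<tau> 1 0
     + \<tau> * e * (y + b) * c * kern W c \<alpha> t y e \<tau> 1 b"
proof -
  \<comment> \<open>After cancelling \<open>t + 3\<close> and \<open>t - 1\<close> against
    \<open>stepe\<close>, both terms contain \<open>W / (t + 1)\<close>, so \<open>W\<close> drops
    out.\<close>
  have edge_diff: "(edge t W c \<tau> 1 / stepe t 1) * (edge (t+2) W c (-\<tau>) 0 / stepe (t+2) 0) * (t+3)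
      - (edge t W c \<tau> 0 / stepe t 0) * (edge t W c \<tau> 1 / stepe t 1) * (t-1)
      = \<tau> * c * (edge t W c \<tau> 1 / stepe t 1)"
  proof -
    have "(t+2)+1 = t+3" "(t+2)-1 = t+1" by simp_all
    then show ?thesis
      using assms by (simp add: edge_def stepe_def divide_simps) (simp add: algebra_simps)
  qed
  show ?thesis
    unfolding kern_mult stepE_intertwine combine_two[OF edge_diff]
    by (simp add: kern_def mult_ac)
qed

lemma kern_intertwine_down:
  assumes "t + 1 \<noteq> 0" "t - 1 \<noteq> 0" "t - 3 \<noteq> 0"
  shows "kern W c \<alpha> t y e \<tau> (-1) 0 * kern W c \<alpha> (t-2) y (-e) (-\<tau>) 0 b
     + kern W c \<alpha> t y e \<tau> 0 0 * kern W c \<alpha> t y e \<tau> (-1) b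
    = kern W c \<alpha> t y e \<tau> (-1) b * kern W c \<alpha> (t-2) (y+2*b) e (-\<tau>) 0 0
     + kern W c \<alpha> t y e \<tau> 0 b * kern W c \<alpha> t (y+2*b) (-e) \<tau> (-1) 0
     + \<tau> * e * (y + b) * c * kern W c \<alpha> t y e \<tau> (-1) b"
proof -
  have edge_diff: "(edge t W c \<tau> (-1) / stepe t (-1)) * (edge (t-2) W c (-\<tau>) 0 / stepe (t-2) 0) * (t-3)
      - (edge t W c \<tau> 0 / stepe t 0) * (edge t W c \<tau> (-1) / stepe t (-1)) * (t+1)
      = \<tau> * c * (edge t W c \<tau> (-1) / stepe t (-1))"
  proof -
    have *: "edge (t-2) W c (-\<tau>) 0 / stepe (t-2) 0 * (t-3) - edge t W c \<tau> 0 / stepe t 0 * (t+1) = \<tau> * c"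
    proof -
      have "(t-2)+1 = t-1" "(t-2)-1 = t-3" by simp_all
      then show ?thesis
        using assms by (simp add: edge_def stepe_def divide_simps) (simp add: algebra_simps)
    qed
    show ?thesis
      using arg_cong[OF *, of "\<lambda>z. z * (edge t W c \<tau> (-1) / stepe t (-1))"]
      by (simp only: left_diff_distrib) (simp add: mult_ac)
  qed
  show ?thesis
    unfolding kern_mult stepE_intertwine combine_two[OF edge_diff]
    by (simp add: kern_def mult_ac)
qed

lemma kern_intertwine_level:
  assumes "t + 1 \<noteq> 0" "t - 1 \<noteq> 0"
  shows "kern W c \<alpha> t y e \<tau> (-1) 0 * kern W c \<alpha> (t-2) y (-e) (-\<tau>) 1 b
     + kern W c \<alpha> t y e \<tau> 1 0 * kern W c \<alpha> (t+2) y (-e) (-\<tau>) (-1) b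
     + kern W c \<alpha> t y e \<tau> 0 0 * kern W c \<alpha> t y e \<tau> 0 b
    = kern W c \<alpha> t y e \<tau> (-1) b * kern W c \<alpha> (t-2) (y+2*b) e (-\<tau>) 1 0
     + kern W c \<alpha> t y e \<tau> 1 b * kern W c \<alpha> (t+2) (y+2*b) e (-\<tau>) (-1) 0
     + kern W c \<alpha> t y e \<tau> 0 b * kern W c \<alpha> t (y+2*b) (-e) \<tau> 0 0
     + \<tau> * e * (y + b) * c * kern W c \<alpha> t y e \<tau> 0 b"
proof -
  \<comment> \<open>Division by \<open>stepe\<close> turns the terms \<open>(t + 1)\<^sup>2\<close>
    and \<open>(t - 1)\<^sup>2\<close> of the two quadratic \<open>edge\<close> values into equal
    constants, which cancel; the squares containing \<open>W\<close> are balanced by the diagonal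
    term.\<close>
  have edge_diff: "(edge t W c \<tau> 1 / stepe t 1) * (edge (t+2) W c (-\<tau>) (-1) / stepe (t+2) (-1)) * 2
      - (edge t W c \<tau> (-1) / stepe t (-1)) * (edge (t-2) W c (-\<tau>) 1 / stepe (t-2) 1) * 2
      - (edge t W c \<tau> 0 / stepe t 0) * (edge t W c \<tau> 0 / stepe t 0) * (2*t)
      = \<tau> * c * (edge t W c \<tau> 0 / stepe t 0)"
  proof -
    have "(t-2)+1 = t-1" "(t+2)-1 = t+1" by simp_all
    then show ?thesis
      using assms tau
      apply (elim disjE; simp add: edge_def stepe_def divide_simps)
      apply (simp_all add: algebra_simps power2_eq_square)
      done
  qed
  show ?thesis
    unfolding kern_mult stepE_intertwine combine_three[OF edge_diff]
    by (simp add: kern_def mult_ac)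
qed

end

section \<open>Normalized univariate polynomials and their recurrence\<close>

text \<open>The product of \<open>norm_eta\<close> and \<open>norm_theta\<close>, regrouped as one
  factor per degree.\<close>

definition BI_scale :: "nat \<Rightarrow> real \<Rightarrow> real \<Rightarrow> real"
  where "BI_scale m y \<alpha> = (\<Prod>l<m. - 4 * (2 * real l + y + \<alpha> + 1) / (real l + \<alpha> + (if odd l then y else 0)))"

text \<open>The \<open>k\<close>-th factor of the renormalized polynomial with its share of
  \<open>norm_k\<close>: \<open>\<sigma>\<close> is the parity sign of
  \<open>nsum n (k - 1)\<close>, and \<open>W\<close>, \<open>Z\<close> are the signed coordinates
  of \<open>x (k + 1)\<close> and \<open>x k\<close>.\<close>

definition BI_fun :: "nat \<Rightarrow> real \<Rightarrow> real \<Rightarrow> real \<Rightarrow> real \<Rightarrow> real \<Rightarrow> real \<Rightarrow> real"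
  where "BI_fun m \<sigma> y \<alpha> c W Z = \<sigma> ^ m * BI_scale m y \<alpha>
    * BI_poly m (\<sigma> * Z / 2 - 1 / 4) ((y - c) / 4) (\<sigma> * W / 2 + (\<alpha> - 1) / 4)
        (\<sigma> * W / 2 - (\<alpha> - 1) / 4) (- (y + c) / 4)"

lemma BI_scale_Suc:
  "BI_scale (Suc m) y \<alpha> = - 4 * (2 * real m + y + \<alpha> + 1) / (real m + \<alpha> + (if odd m then y else 0)) * BI_scale m y \<alpha>"
  by (simp add: BI_scale_def)

context
  fixes y \<alpha> c W \<sigma> :: real
  assumes y: "y > 0" and \<alpha>: "\<alpha> > 1" and \<sigma>: "\<sigma> = 1 \<or> \<sigma> = -1"
begin

abbreviation "BA \<equiv> BI_A ((y - c) / 4) (\<sigma> * W / 2 + (\<alpha> - 1) / 4) (\<sigma> * W / 2 - (\<alpha> - 1) / 4) (- (y + c) / 4)"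
abbreviation "BC \<equiv> BI_C ((y - c) / 4) (\<sigma> * W / 2 + (\<alpha> - 1) / 4) (\<sigma> * W / 2 - (\<alpha> - 1) / 4) (- (y + c) / 4)"
abbreviation "kernm m \<equiv> kern W c \<alpha> (2 * real m + y + \<alpha>) y ((-1) ^ m) (\<sigma> * (-1) ^ m)"

lemma BA_eq:
  "BA m = (if even m then (real m + (y - c + \<alpha> + 1) / 2 - \<sigma> * W) * (real m + y + 1)
     else (real m + y + \<alpha>) * (real m + (y - c + \<alpha> + 1) / 2 + \<sigma> * W)) / (2 * (2 * real m + y + \<alpha> + 1))"
proof -
  have d: "4 * (real m + (y - c) / 4 + (\<sigma> * W / 2 + (\<alpha> - 1) / 4) - (\<sigma> * W / 2 - (\<alpha> - 1) / 4) - (- (y + c) / 4) + 1)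
    = 2 * (2 * real m + y + \<alpha> + 1)" by (simp add: field_simps)
  have "2 * real m + y + \<alpha> + 1 > 0" using y \<alpha> by simp
  then show ?thesis
    unfolding BI_A_def Let_def d
    by (cases "even m") (simp_all add: even_iff_mod_2_eq_zero odd_iff_mod_2_eq_one field_simps)
qed

lemma BC_eq:
  "BC m = - (if even m then real m * (real m + (y + c + \<alpha> - 1) / 2 - \<sigma> * W)
     else (real m + (y + c + \<alpha> - 1) / 2 + \<sigma> * W) * (real m + \<alpha> - 1)) / (2 * (2 * real m + y + \<alpha> - 1))"
proof -
  have d: "4 * (real m + (y - c) / 4 + (\<sigma> * W / 2 + (\<alpha> - 1) / 4) - (\<sigma> * W / 2 - (\<alpha> - 1) / 4) - (- (y + c) / 4))
    = 2 * (2 * real m + y + \<alpha> - 1)" by (simp add: field_simps)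
  have "2 * real m + y + \<alpha> - 1 > 0" using y \<alpha> by simp
  then show ?thesis
    unfolding BI_C_def Let_def d
    by (cases "even m") (simp_all add: even_iff_mod_2_eq_zero odd_iff_mod_2_eq_one field_simps)
qed

text \<open>The recurrence of \<open>BI_poly\<close> in the variable
  \<open>\<sigma> * Z / 2 - 1 / 4\<close> is multiplied by \<open>- 2 * \<sigma>\<close>; the
  summand \<open>- \<sigma> / 2\<close> accounts for the \<open>1 / 4\<close>.\<close>

lemma kern_diag: "kernm m 0 0 = \<sigma> * y * c / 2 - \<sigma> / 2 - 2 * \<sigma> * ((y - c) / 4 - BA m - BC m)"
proof -
  define t where "t = 2 * real m + y + \<alpha>"
  have t: "t + 1 \<noteq> 0" "t - 1 \<noteq> 0" using y \<alpha> by (simp_all add: t_def)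
  have m: "real m = (t - y - \<alpha>) / 2" by (simp add: t_def)
  have *: "2 * ((t - y - \<alpha>) / 2) + y + \<alpha> = t" by (simp add: field_simps)
  show ?thesis
    unfolding BA_eq BC_eq m * kern_def edge_def stepE_def stepe_def
    using t \<sigma>
    apply (cases "even m"; elim disjE; simp add: divide_simps)
    apply (simp_all add: algebra_simps power2_eq_square)
    done
qed

text \<open>\<open>BI_poly\<close> is monic, so the ratio of consecutive values of
  \<open>BI_scale\<close> must make the raising coefficient constant.\<close>

lemma kern_up: "kernm m 1 0 * BI_scale (Suc m) y \<alpha> = - 2 * BI_scale m y \<alpha>"
proof -
  have "real m + \<alpha> > 0" "real m + \<alpha> + y > 0" "2 * real m + y + \<alpha> + 1 > 0"
    using y \<alpha> by (simp_all add: add_pos_pos add_nonneg_pos)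
  then show ?thesis
    by (cases "even m") (simp_all add: BI_scale_Suc kern_def edge_def stepE_def stepe_def divide_simps,
      simp_all add: algebra_simps)
qed

lemma kern_down:
  "kernm (Suc m) (-1) 0 * BI_scale m y \<alpha> = - 2 * BA m * BC (Suc m) * BI_scale (Suc m) y \<alpha>"
proof -
  have pos: "real m + \<alpha> \<noteq> 0" "real m + \<alpha> + y \<noteq> 0" "2 * real m + y + \<alpha> + 1 \<noteq> 0"
    using y \<alpha> by (simp_all add: add_pos_pos add_nonneg_pos)
  have *: "2 * real (Suc m) + y + \<alpha> - 1 = 2 * real m + y + \<alpha> + 1" by simp
  have "kernm (Suc m) (-1) 0 = - 2 * BA m * BC (Suc m) * (- 4 * (2 * real m + y + \<alpha> + 1) / (real m + \<alpha> + (if odd m then y else 0)))"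
    unfolding BA_eq BC_eq kern_def edge_def stepE_def stepe_def *
    using pos \<sigma>
    apply (cases "even m"; elim disjE; simp add: divide_simps)
    apply (simp_all add: algebra_simps power2_eq_square)
    done
  then show ?thesis by (simp add: BI_scale_Suc)
qed

lemma BI_fun_recurrence:
  "kernm m 1 0 * BI_fun (Suc m) \<sigma> y \<alpha> c W Z + kernm m 0 0 * BI_fun m \<sigma> y \<alpha> c W Z
     + kernm m (-1) 0 * BI_fun (m - 1) \<sigma> y \<alpha> c W Z
   = edge y Z c \<sigma> 0 * BI_fun m \<sigma> y \<alpha> c W Z"
proof -
  have \<sigma>2: "\<sigma> * \<sigma> = 1" using \<sigma> by auto
  define P where "P m = BI_poly m (\<sigma> * Z / 2 - 1 / 4) ((y - c) / 4) (\<sigma> * W / 2 + (\<alpha> - 1) / 4)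
        (\<sigma> * W / 2 - (\<alpha> - 1) / 4) (- (y + c) / 4)" for m
  have f: "BI_fun m \<sigma> y \<alpha> c W Z = \<sigma> ^ m * BI_scale m y \<alpha> * P m" for m
    by (simp add: BI_fun_def P_def)
  have e0: "edge y Z c \<sigma> 0 = - Z + \<sigma> * y * c / 2" by (simp add: edge_def)
  have up: "kernm m 1 0 * BI_fun (Suc m) \<sigma> y \<alpha> c W Z = - 2 * \<sigma> * (\<sigma> ^ m * BI_scale m y \<alpha>) * P (Suc m)"
    using arg_cong[OF kern_up[of m], of "\<lambda>z. z * (\<sigma> ^ Suc m * P (Suc m))"] by (simp add: f mult_ac)
  show ?thesis
  proof (cases m)
    case 0
    \<comment> \<open>In degree 0 the predecessor in \<open>nat\<close> is 0 again; the lowering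
      term disappears only because its coefficient vanishes.\<close>
    have z: "kernm 0 (-1) 0 = 0" by (simp add: kern_def stepE_def)
    have c: "BC 0 = 0" by (subst BC_eq) simp
    have "P (Suc 0) = \<sigma> * Z / 2 - 1 / 4 - ((y - c) / 4 - BA 0 - BC 0)" "P 0 = 1"
      by (simp_all add: P_def)
    with up kern_diag[of 0] z e0 \<sigma>2 show ?thesis unfolding 0
      by (simp add: f) (simp add: algebra_simps)
  next
    case (Suc k)
    have P: "P (Suc (Suc k)) = (\<sigma> * Z / 2 - 1 / 4 - ((y - c) / 4 - BA (Suc k) - BC (Suc k))) * P (Suc k)
       - BA k * BC (Suc k) * P k"
      by (simp add: P_def)
    have down: "kernm (Suc k) (-1) 0 * BI_fun k \<sigma> y \<alpha> c W Z
      = - 2 * \<sigma> * (\<sigma> ^ Suc k * BI_scale (Suc k) y \<alpha>) * (BA k * BC (Suc k) * P k)"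
      using arg_cong[OF kern_down[of k], of "\<lambda>z. z * (\<sigma> ^ k * P k)"] \<sigma>2 by (simp add: f mult_ac)
    define L where "L = \<sigma> ^ Suc k * BI_scale (Suc k) y \<alpha>"
    have z: "\<sigma> * (\<sigma> * x) = x" for x using \<sigma>2 by (simp flip: mult.assoc)
    define D where "D = (y - c) / 4 - BA (Suc k) - BC (Suc k)"
    show ?thesis unfolding Suc diff_Suc_1 up[unfolded Suc] down P kern_diag e0 f[of "Suc k"]
      unfolding L_def[symmetric] D_def[symmetric]
      by (simp add: algebra_simps z)
  qed
qed

end

section \<open>Contiguity relations through a common recurrence in the degree\<close>

text \<open>A three-term operator with coefficients \<open>p\<close>, \<open>q\<close>,
  \<open>r\<close> that intertwines two recurrences up to the scalar \<open>g\<close> maps solutions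
  with eigenvalue \<open>d\<close> to solutions with eigenvalue \<open>d + g\<close>. The premises
  keep the factors \<open>x2\<close> to \<open>y2\<close> and \<open>p\<close>, \<open>q\<close>,
  \<open>r\<close>, so nothing is demanded where a polynomial or the coefficient in front of it
  vanishes.\<close>

lemma recurrence_transport:
  fixes x2 x1 x0 y1 y2 :: real
  assumes "pp * x2 * u = p * a1 * x2"
    and "(u * qp + v * p) * x1 = (p * a0 + q * b1 + g * p) * x1"
    and "(w * pm + u * rp + v * q) * x0 = (r * c1 + p * a2 + q * b0 + g * q) * x0"
    and "(w * qm + v * r) * y1 = (r * c0 + q * b2 + g * r) * y1"
    and "w * rm * y2 = r * c2 * y2"
    and "p * (a1 * x2 + a0 * x1 + a2 * x0) = p * (d * x1)"
    and "q * (b1 * x1 + b0 * x0 + b2 * y1) = q * (d * x0)"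
    and "r * (c1 * x0 + c0 * y1 + c2 * y2) = r * (d * y1)"
  shows "u * (pp * x2 + qp * x1 + rp * x0) + v * (p * x1 + q * x0 + r * y1)
      + w * (pm * x0 + qm * y1 + rm * y2) = (d + g) * (p * x1 + q * x0 + r * y1)"
proof -
  have "u * (pp * x2 + qp * x1 + rp * x0) + v * (p * x1 + q * x0 + r * y1)
      + w * (pm * x0 + qm * y1 + rm * y2)
    = pp * x2 * u + (u * qp + v * p) * x1 + (w * pm + u * rp + v * q) * x0 + (w * qm + v * r) * y1
      + w * rm * y2"
    by (simp add: algebra_simps)
  also have "\<dots> = p * (a1 * x2 + a0 * x1 + a2 * x0) + q * (b1 * x1 + b0 * x0 + b2 * y1)
      + r * (c1 * x0 + c0 * y1 + c2 * y2) + g * (p * x1 + q * x0 + r * y1)"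
    unfolding assms(1-5) by (simp add: algebra_simps)
  also have "\<dots> = (d + g) * (p * x1 + q * x0 + r * y1)"
    unfolding assms(6-8) by (simp add: algebra_simps)
  finally show ?thesis .
qed

definition par :: "int \<Rightarrow> real"
  where "par j = (if even j then 1 else -1)"

lemma par_shift [simp]: "par (j + 1) = - par j" "par (1 + j) = - par j" "par (j - 1) = - par j"
  by (simp_all add: par_def)

lemma par_cases: "par j = 1 \<or> par j = -1"
  by (simp add: par_def)

text \<open>Extension by zero to negative degrees, which makes the shifted degrees
  \<open>j + a - b\<close> always meaningful.\<close>

definition BI_int :: "int \<Rightarrow> real \<Rightarrow> real \<Rightarrow> real \<Rightarrow> real \<Rightarrow> real \<Rightarrow> real \<Rightarrow> real"
  where "BI_int j \<sigma> y \<alpha> c W Z = (if j < 0 then 0 else BI_fun (nat j) \<sigma> y \<alpha> c W Z)"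

definition kernj :: "real \<Rightarrow> real \<Rightarrow> real \<Rightarrow> real \<Rightarrow> real \<Rightarrow> int \<Rightarrow> int \<Rightarrow> int \<Rightarrow> real"
  where "kernj W c \<alpha> y \<sigma> j a b = kern W c \<alpha> (2 * real_of_int j + y + \<alpha>) y (par j) (\<sigma> * par j) a b"

text \<open>Only four transitions lead below degree 0, three from degree 0 and one from degree 1.
  Each has coefficient 0, which justifies omitting such terms.\<close>

lemma stepE_eq_0:
  assumes "0 \<le> j" "j + a - b < 0" "a \<in> {-1,0,1}" "b \<in> {-1,0,1}"
  shows "stepE (2 * real_of_int j + y + \<alpha>) y \<alpha> (par j) a b = 0"
proof -
  have "(j = 0 \<and> a = -1 \<and> b = 0) \<or> (j = 0 \<and> a = -1 \<and> b = 1) \<or> (j = 0 \<and> a = 0 \<and> b = 1)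
      \<or> (j = 1 \<and> a = -1 \<and> b = 1)"
    using assms unfolding insert_iff empty_iff by presburger
  then show ?thesis by (elim disjE conjE) (simp_all add: stepE_def par_def)
qed

lemma kernj_eq_0:
  assumes "0 \<le> j" "j + a - b < 0" "a \<in> {-1,0,1}" "b \<in> {-1,0,1}"
  shows "kernj W c \<alpha> y \<sigma> j a b = 0"
  unfolding kernj_def kern_def stepE_eq_0[OF assms] by simp

lemma BI_int_recurrence:
  assumes "y > 0" "\<alpha> > 1" "\<sigma> = 1 \<or> \<sigma> = -1" "j \<ge> 0"
  shows "kernj W c \<alpha> y \<sigma> j 1 0 * BI_int (j + 1) \<sigma> y \<alpha> c W Z
      + kernj W c \<alpha> y \<sigma> j 0 0 * BI_int j \<sigma> y \<alpha> c W Z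
      + kernj W c \<alpha> y \<sigma> j (-1) 0 * BI_int (j - 1) \<sigma> y \<alpha> c W Z
    = edge y Z c \<sigma> 0 * BI_int j \<sigma> y \<alpha> c W Z"
proof -
  define m where "m = nat j"
  have j: "j = int m" using assms by (simp add: m_def)
  have par: "par (int m) = (-1) ^ m" by (simp add: par_def)
  have suc: "nat (int m + 1) = Suc m" by simp
  have down: "kernj W c \<alpha> y \<sigma> (int m) (-1) 0 * BI_int (int m - 1) \<sigma> y \<alpha> c W Z
    = kernj W c \<alpha> y \<sigma> (int m) (-1) 0 * BI_fun (m - 1) \<sigma> y \<alpha> c W Z"
  proof (cases m)
    case 0
    then show ?thesis by (simp add: kernj_eq_0)
  next
    case (Suc k)
    then show ?thesis by (simp add: BI_int_def)
  qed
  show ?thesis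
    using BI_fun_recurrence[OF assms(1-3), of W c m Z]
    unfolding j down unfolding BI_int_def kernj_def par suc by simp
qed

text \<open>Lets the recurrence be solved for the highest degree, so that a solution is determined
  by its value in degree 0.\<close>

lemma kernj_up_neq_0:
  assumes "y > 0" "\<alpha> > 1" "j \<ge> 0"
  shows "kernj W c \<alpha> y \<sigma> j 1 0 \<noteq> 0"
proof -
  have "2 * real_of_int j + y + \<alpha> + 1 > 0" "real_of_int j + \<alpha> > 0" using assms by simp_all
  then show ?thesis
    using assms by (cases "even j") (simp_all add: kernj_def kern_def edge_def stepE_def stepe_def par_def)
qed

context
  fixes y \<alpha> c W Z \<sigma> :: real and b :: int
  assumes y: "y > 0" "y + 2 * b > 0" and \<alpha>: "\<alpha> > 1" and \<sigma>: "\<sigma> = 1 \<or> \<sigma> = -1" and b: "b = 1 \<or> b = -1"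
begin

abbreviation "F' j \<equiv> BI_int j (- \<sigma>) (y + 2 * b) \<alpha> c W Z"

text \<open>The left side of the contiguity relation. In \<open>F'\<close> the sign is
  \<open>- \<sigma>\<close> because a shift by \<open>b\<close> changes the parity of the lower
  partial sum.\<close>

definition contig :: "int \<Rightarrow> real"
  where "contig j = kernj W c \<alpha> y \<sigma> j 1 b * F' (j + 1 - b) + kernj W c \<alpha> y \<sigma> j 0 b * F' (j - b)
    + kernj W c \<alpha> y \<sigma> j (-1) b * F' (j - 1 - b)"

text \<open>\<open>contig\<close> combines solutions at \<open>y + 2 * b\<close>; the intertwining
  relations carry their recurrence over to the one at \<open>y\<close>.\<close>

lemma contig_recurrence:
  assumes j: "j \<ge> 0"
  shows "kernj W c \<alpha> y \<sigma> j 1 0 * contig (j + 1) + kernj W c \<alpha> y \<sigma> j 0 0 * contig j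
      + kernj W c \<alpha> y \<sigma> j (-1) 0 * contig (j - 1)
    = edge y Z c \<sigma> 0 * contig j"
proof -
  define t where "t = 2 * real_of_int j + y + \<alpha>"
  define e where "e = par j"
  define \<tau> where "\<tau> = \<sigma> * e"
  define k where "k = kern W c \<alpha>"
  have e: "e = 1 \<or> e = -1" by (simp add: e_def par_def)
  have \<tau>: "\<tau> = 1 \<or> \<tau> = -1" using e \<sigma> by (auto simp: \<tau>_def)
  have t: "t + 1 > 0" "t - 1 > 0" "t + 3 > 0" using y \<alpha> j by (simp_all add: t_def)
  \<comment> \<open>For \<open>b = 1\<close>, \<open>j = 0\<close> a denominator may vanish, but then it multiplies a polynomial of negative index.\<close>
  have t3: "t - 3 \<noteq> 0 \<or> F' (j - 1 - b) = 0"
  proof (cases "b = 1 \<and> j = 0")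
    case True
    then show ?thesis by (simp add: BI_int_def)
  next
    case False
    then have "real_of_int j \<ge> 1 \<or> y > 2" using b j y by auto
    with y \<alpha> j show ?thesis by (auto simp: t_def)
  qed
  have \<tau>e: "\<tau> * e = \<sigma>" using e by (auto simp: \<tau>_def)
  have parb: "par (j - b) = - e" "par (j + 1 - b) = e" "par (j - 1 - b) = e"
    using b by (auto simp: e_def par_def)
  have kj: "kernj W c \<alpha> y \<sigma> j = k t y e \<tau>"
      "kernj W c \<alpha> y \<sigma> (j + 1) = k (t + 2) y (- e) (- \<tau>)"
      "kernj W c \<alpha> y \<sigma> (j - 1) = k (t - 2) y (- e) (- \<tau>)"
    by (rule ext, simp add: kernj_def k_def t_def e_def \<tau>_def algebra_simps)+
  have arith: "2 * real_of_int (j + 1 - b) + (y + 2*b) + \<alpha> = t + 2"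
    "2 * real_of_int (j - b) + (y + 2*b) + \<alpha> = t"
    "2 * real_of_int (j - 1 - b) + (y + 2*b) + \<alpha> = t - 2"
    by (simp_all add: t_def)
  have kb: "kernj W c \<alpha> (y + 2*b) (-\<sigma>) (j + 1 - b) = k (t + 2) (y + 2*b) e (-\<tau>)"
    "kernj W c \<alpha> (y + 2*b) (-\<sigma>) (j - b) = k t (y + 2*b) (-e) \<tau>"
    "kernj W c \<alpha> (y + 2*b) (-\<sigma>) (j - 1 - b) = k (t - 2) (y + 2*b) e (-\<tau>)"
    by (simp_all only: fun_eq_iff kernj_def arith parb k_def \<tau>_def mult_minus_left mult_minus_right
      minus_minus simp_thms)
  have edge: "edge y Z c \<sigma> 0 = edge (y + 2*b) Z c (-\<sigma>) 0 + \<tau> * e * (y + b) * c"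
    by (simp add: edge_def \<tau>e field_simps)
  have bmem: "b \<in> {-1,0,1}" using b by auto
  \<comment> \<open>Multiplied by the coefficient in front, the recurrence holds in negative degrees
    too, since that coefficient is then 0.\<close>
  have rec: "kernj W c \<alpha> y \<sigma> j a b *
     (kernj W c \<alpha> (y + 2*b) (-\<sigma>) (j + a - b) 1 0 * F' (j + a - b + 1)
      + kernj W c \<alpha> (y + 2*b) (-\<sigma>) (j + a - b) 0 0 * F' (j + a - b)
      + kernj W c \<alpha> (y + 2*b) (-\<sigma>) (j + a - b) (-1) 0 * F' (j + a - b - 1))
    = kernj W c \<alpha> y \<sigma> j a b * (edge (y + 2*b) Z c (-\<sigma>) 0 * F' (j + a - b))" if a: "a \<in> {-1,0,1}" for a
  proof (cases "j + a - b < 0")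
    case True
    then show ?thesis by (simp add: kernj_eq_0[OF j True a bmem])
  next
    case False
    then show ?thesis using BI_int_recurrence[of "y+2*b" \<alpha> "-\<sigma>" "j+a-b" W c Z] y \<alpha> \<sigma> by auto
  qed
  note ctx = e \<tau> b
  have shift: "j + 1 + 1 - b = j + 2 - b" "j + 1 - b + 1 = j + 2 - b" "j - b + 1 = j + 1 - b"
     "j - b - 1 = j - 1 - b" "j - 1 - b + 1 = j - b" "j + 1 - b - 1 = j - b" "j - 1 - 1 - b = j - 2 - b"
     "j - 1 - b - 1 = j - 2 - b" "j + 1 - 1 - b = j - b" "j - 1 + 1 - b = j - b" "j + 0 - b = j - b"
     "j + -1 - b = j - 1 - b" by simp_all
  have mem: "(1::int) \<in> {-1,0,1}" "(0::int) \<in> {-1,0,1}" "(-1::int) \<in> {-1,0,1}" by simp_all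
  note rec1 = rec[OF mem(1), unfolded shift kj kb]
  note rec0 = rec[OF mem(2), unfolded shift kj kb]
  note rec_1 = rec[OF mem(3), unfolded shift kj kb]
  have 1: "k (t + 2) y (- e) (- \<tau>) 1 b * F' (j + 2 - b) * k t y e \<tau> 1 0
    = k t y e \<tau> 1 b * k (t + 2) (y + 2*b) e (-\<tau>) 1 0 * F' (j + 2 - b)"
    unfolding k_def kern_intertwine_up_up[OF ctx, of W c \<alpha> t y, symmetric] by (simp only: mult_ac)
  have 2: "(k t y e \<tau> 1 0 * k (t + 2) y (- e) (- \<tau>) 0 b + k t y e \<tau> 0 0 * k t y e \<tau> 1 b) * F' (j + 1 - b)
    = (k t y e \<tau> 1 b * k (t + 2) (y + 2*b) e (-\<tau>) 0 0 + k t y e \<tau> 0 b * k t (y + 2*b) (-e) \<tau> 1 0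
        + \<tau> * e * (y + b) * c * k t y e \<tau> 1 b) * F' (j + 1 - b)"
    using kern_intertwine_up[OF ctx, of t W c \<alpha> y] t unfolding k_def by (simp only: less_imp_neq[symmetric] simp_thms)
  have 3: "(k t y e \<tau> (-1) 0 * k (t - 2) y (- e) (- \<tau>) 1 b + k t y e \<tau> 1 0 * k (t + 2) y (- e) (- \<tau>) (-1) b
        + k t y e \<tau> 0 0 * k t y e \<tau> 0 b) * F' (j - b)
    = (k t y e \<tau> (-1) b * k (t - 2) (y + 2*b) e (-\<tau>) 1 0 + k t y e \<tau> 1 b * k (t + 2) (y + 2*b) e (-\<tau>) (-1) 0
        + k t y e \<tau> 0 b * k t (y + 2*b) (-e) \<tau> 0 0 + \<tau> * e * (y + b) * c * k t y e \<tau> 0 b) * F' (j - b)"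
    using kern_intertwine_level[OF ctx, of t W c \<alpha> y] t unfolding k_def by (simp only: less_imp_neq[symmetric] simp_thms)
  have 4: "(k t y e \<tau> (-1) 0 * k (t - 2) y (- e) (- \<tau>) 0 b + k t y e \<tau> 0 0 * k t y e \<tau> (-1) b) * F' (j - 1 - b)
    = (k t y e \<tau> (-1) b * k (t - 2) (y + 2*b) e (-\<tau>) 0 0 + k t y e \<tau> 0 b * k t (y + 2*b) (-e) \<tau> (-1) 0
        + \<tau> * e * (y + b) * c * k t y e \<tau> (-1) b) * F' (j - 1 - b)"
    using t3
  proof
    assume "t - 3 \<noteq> 0"
    then show ?thesis using kern_intertwine_down[OF ctx, of t W c \<alpha> y] t unfolding k_def
      by (simp only: less_imp_neq[symmetric] simp_thms)
  qed simp
  have 5: "k t y e \<tau> (-1) 0 * k (t - 2) y (- e) (- \<tau>) (-1) b * F' (j - 2 - b)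
    = k t y e \<tau> (-1) b * k (t - 2) (y + 2*b) e (-\<tau>) (-1) 0 * F' (j - 2 - b)"
    unfolding k_def kern_intertwine_down_down[OF ctx, of W c \<alpha> t y, symmetric] by (rule refl)
  show ?thesis
    unfolding contig_def edge kj shift
    by (rule recurrence_transport[OF 1 2 3 4 5 rec1 rec0 rec_1])
qed

text \<open>For \<open>b = 1\<close> only the term \<open>a = 1\<close> survives. For
  \<open>b = -1\<close> the degrees 2, 1 and 0 occur, and the first two are eliminated by the
  recurrence at \<open>y - 2\<close>.\<close>

lemma contig_0: "contig 0 = edge y Z c \<sigma> b * BI_int 0 \<sigma> y \<alpha> c W Z"
  using b
proof
  assume b: "b = 1"
  have "kernj W c \<alpha> y \<sigma> 0 0 b = 0" "kernj W c \<alpha> y \<sigma> 0 (-1) b = 0"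
    by (rule kernj_eq_0; simp add: b)+
  moreover have "kernj W c \<alpha> y \<sigma> 0 1 b = 1 / 2"
    using y \<alpha> by (simp add: b kernj_def kern_def edge_def stepE_def stepe_def par_def divide_simps)
  ultimately show ?thesis
    unfolding contig_def by (simp add: b edge_def BI_int_def BI_fun_def BI_scale_def)
next
  assume b: "b = -1"
  define t where "t = y + \<alpha>"
  define E where "E = - Z - \<sigma> * (y - 2) * c / 2"
  have t: "t - 1 > 0" "t + 1 > 0" "t - 3 > 0" using y \<alpha> b by (simp_all add: t_def)
  have y2: "y - 2 > 0" using y b by simp
  have E: "edge (y - 2) Z c (-\<sigma>) 0 = E" by (simp add: edge_def E_def)
  have F0: "F' 0 = 1" by (simp add: BI_int_def BI_fun_def BI_scale_def)
  have F_neg: "F' (-1) = 0" by (simp add: BI_int_def)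
  have yt: "y = t - \<alpha>" by (simp add: t_def)
  have kb1: "kernj W c \<alpha> (y - 2) (-\<sigma>) 1 1 0 = (t - 1) / (2 * (t + 1))"
    "kernj W c \<alpha> (y - 2) (-\<sigma>) 1 0 0 = (- W + \<sigma> * t * c / 2) * (1 - \<alpha> + t * (y - 2)) / (- (t + 1) * (t - 1))"
    "kernj W c \<alpha> (y - 2) (-\<sigma>) 1 (-1) 0 = ((2 * W - \<sigma> * c)\<^sup>2 - (t - 1)\<^sup>2) / 2 * (y - 1) / (t - 1)"
    using t by (simp_all add: kernj_def kern_def edge_def stepE_def stepe_def par_def yt divide_simps)
      (simp_all add: algebra_simps)
  have kb0: "kernj W c \<alpha> (y - 2) (-\<sigma>) 0 1 0 = \<alpha> / (2 * (t - 1))"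
    "kernj W c \<alpha> (y - 2) (-\<sigma>) 0 0 0 = (- W - \<sigma> * (t - 2) * c / 2) * (1 - \<alpha> - (t - 2) * (y - 2)) / (- (t - 1) * (t - 3))"
    using t by (simp_all add: kernj_def kern_def edge_def stepE_def stepe_def par_def yt divide_simps)
      (simp_all add: algebra_simps)
  have k: "kernj W c \<alpha> y \<sigma> 0 1 (-1) = \<alpha> / (2 * (t + 1))"
    "kernj W c \<alpha> y \<sigma> 0 0 (-1) = (- W + \<sigma> * t * c / 2) * (y - \<alpha> - t) / (- (t + 1) * (t - 1))"
    "kernj W c \<alpha> y \<sigma> 0 (-1) (-1) = ((2 * W - \<sigma> * c)\<^sup>2 - (t - 1)\<^sup>2) / 2 * (y - 1) / (t - 1)"
    using t by (simp_all add: kernj_def kern_def edge_def stepE_def stepe_def par_def yt divide_simps)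
      (simp_all add: algebra_simps)
  have rec0: "\<alpha> / (2 * (t - 1)) * F' 1 + (- W - \<sigma> * (t - 2) * c / 2) * (1 - \<alpha> - (t - 2) * (y - 2)) / (- (t - 1) * (t - 3)) = E"
    using BI_int_recurrence[of "y - 2" \<alpha> "-\<sigma>" 0 W c Z] y2 \<alpha> \<sigma> F0 F_neg by (auto simp: b E kb0)
  have rec1: "(t - 1) / (2 * (t + 1)) * F' 2
      + (- W + \<sigma> * t * c / 2) * (1 - \<alpha> + t * (y - 2)) / (- (t + 1) * (t - 1)) * F' 1
      + ((2 * W - \<sigma> * c)\<^sup>2 - (t - 1)\<^sup>2) / 2 * (y - 1) / (t - 1) = E * F' 1"
    using BI_int_recurrence[of "y - 2" \<alpha> "-\<sigma>" 1 W c Z] y2 \<alpha> \<sigma> F0 by (auto simp: b E kb1)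
  define g where "g = (- W - \<sigma> * (t - 2) * c / 2) * (1 - \<alpha> - (t - 2) * (y - 2)) / (- (t - 1) * (t - 3))"
  define h where "h = (- W + \<sigma> * t * c / 2) * (1 - \<alpha> + t * (y - 2)) / (- (t + 1) * (t - 1))"
  define H where "H = ((2 * W - \<sigma> * c)\<^sup>2 - (t - 1)\<^sup>2) / 2"
  have F1: "F' 1 = 2 * (t - 1) / \<alpha> * (E - g)"
    using rec0 t \<alpha> unfolding g_def[symmetric] by (simp add: field_simps)
  have F2: "F' 2 = 2 * (t + 1) / (t - 1) * ((E - h) * F' 1 - H * (y - 1) / (t - 1))"
  proof -
    have "(t - 1) / (2 * (t + 1)) * F' 2 = (E - h) * F' 1 - H * (y - 1) / (t - 1)"
      using rec1 unfolding h_def[symmetric] H_def[symmetric] left_diff_distrib by linarith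
    then have "2 * (t + 1) / (t - 1) * ((t - 1) / (2 * (t + 1)) * F' 2)
      = 2 * (t + 1) / (t - 1) * ((E - h) * F' 1 - H * (y - 1) / (t - 1))" by simp
    then show ?thesis using t by simp
  qed
  have scale: "\<alpha> / (2 * (t + 1)) * (2 * (t + 1) / (t - 1) * X) = \<alpha> / (t - 1) * X" for X
    using t by (simp add: divide_simps)
  have F2': "\<alpha> / (2 * (t + 1)) * F' 2 = \<alpha> / (t - 1) * ((E - h) * F' 1 - H * (y - 1) / (t - 1))"
    unfolding F2 scale by (rule refl)
  have shift: "0 + 1 - b = 2" "0 - b = 1" "0 - 1 - b = 0" "0 + 1 - (-1) = (2::int)" "0 - (-1) = (1::int)" "0 - 1 - (-1) = (0::int)"
    using b by simp_all
  have "contig 0 = \<alpha> / (t - 1) * ((E - h) * F' 1 - H * (y - 1) / (t - 1))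
      + (- W + \<sigma> * t * c / 2) * (y - \<alpha> - t) / (- (t + 1) * (t - 1)) * F' 1 + H * (y - 1) / (t - 1)"
    unfolding contig_def shift F0 unfolding b k F2'[unfolded b] H_def[symmetric] by simp
  also have "\<dots> = 2 * (E - h) * (E - g)
      + (- W + \<sigma> * t * c / 2) * 4 / (t + 1) * (E - g) + H * (y - 1)\<^sup>2 / (t - 1)\<^sup>2"
  proof -
    have "(y - \<alpha> - t) * (2 * (t - 1) / \<alpha> * x) / (- (t + 1) * (t - 1)) = 4 / (t + 1) * x" for x
      using t \<alpha> by (simp add: yt divide_simps) (simp add: algebra_simps)
    note * = this
    have "(- W + \<sigma> * t * c / 2) * (y - \<alpha> - t) / (- (t + 1) * (t - 1)) * F' 1
       = (- W + \<sigma> * t * c / 2) * 4 / (t + 1) * (E - g)"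
      using arg_cong[OF *[of "E - g"], of "(*) (- W + \<sigma> * t * c / 2)"] unfolding F1
      by (simp only: times_divide_eq_left times_divide_eq_right mult_ac)
    moreover have "\<alpha> / (t - 1) * ((E - h) * (2 * (t - 1) / \<alpha> * x) - H * (y - 1) / (t - 1)) + H * (y - 1) / (t - 1)
        = 2 * (E - h) * x + H * (y - 1)\<^sup>2 / (t - 1)\<^sup>2" for x
      using t \<alpha> unfolding yt by (simp add: divide_simps) (simp add: algebra_simps power2_eq_square)
    from this[of "E - g"] have "\<alpha> / (t - 1) * ((E - h) * F' 1 - H * (y - 1) / (t - 1)) + H * (y - 1) / (t - 1)
        = 2 * (E - h) * (E - g) + H * (y - 1)\<^sup>2 / (t - 1)\<^sup>2"
      unfolding F1 .
    ultimately show ?thesis by linarith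
  qed
  \<comment> \<open>Here \<open>W\<close> cancels; the quadratic that remains is \<open>edge\<close>
    with \<open>Z\<close> for \<open>W\<close> and \<open>y\<close> for \<open>t\<close>.\<close>
  also have "\<dots> = ((2 * Z - \<sigma> * c)\<^sup>2 - (y - 1)\<^sup>2) / 2"
  proof -
    have g: "g = (- W - \<sigma> * (t - 2) * c / 2) * (t - 1 - \<alpha>) / (t - 1)"
      using t by (simp add: g_def yt divide_simps) (simp add: algebra_simps)
    show ?thesis
      using \<sigma> t unfolding g h_def H_def E_def yt
      apply (elim disjE; simp add: divide_simps)
      apply (simp_all add: algebra_simps power2_eq_square)
      done
  qed
  also have "\<dots> = edge y Z c \<sigma> b * BI_int 0 \<sigma> y \<alpha> c W Z"
    by (simp add: b edge_def BI_int_def BI_fun_def BI_scale_def)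
  finally show ?thesis .
qed

text \<open>Both sides agree in degree 0 and satisfy the recurrence at \<open>y\<close>, whose
  raising coefficient is nonzero.\<close>

lemma contig_eq:
  "contig (int m) = edge y Z c \<sigma> b * BI_int (int m) \<sigma> y \<alpha> c W Z"
proof (induction m rule: less_induct)
  case (less m)
  show ?case
  proof (cases m)
    case 0
    then show ?thesis using contig_0 by simp
  next
    case (Suc k)
    define j where "j = int k"
    have down: "kernj W c \<alpha> y \<sigma> j (-1) 0 * contig (j - 1)
      = kernj W c \<alpha> y \<sigma> j (-1) 0 * (edge y Z c \<sigma> b * BI_int (j - 1) \<sigma> y \<alpha> c W Z)"
    proof (cases k)
      case 0
      then show ?thesis by (simp add: j_def kernj_eq_0)
    next
      case (Suc i)
      then show ?thesis using less[of i] \<open>m = Suc k\<close> by (simp add: j_def)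
    qed
    have IH: "contig j = edge y Z c \<sigma> b * BI_int j \<sigma> y \<alpha> c W Z"
      using less[of k] Suc by (simp add: j_def)
    have j: "j \<ge> 0" by (simp add: j_def)
    have "kernj W c \<alpha> y \<sigma> j 1 0 * contig (j + 1)
      = edge y Z c \<sigma> b * (kernj W c \<alpha> y \<sigma> j 1 0 * BI_int (j + 1) \<sigma> y \<alpha> c W Z)"
      using contig_recurrence[OF j] arg_cong[OF BI_int_recurrence[OF y(1) \<alpha> \<sigma> j, of W c Z], of "(*) (edge y Z c \<sigma> b)"]
      unfolding IH down by algebra
    then have "kernj W c \<alpha> y \<sigma> j 1 0 * contig (j + 1)
      = kernj W c \<alpha> y \<sigma> j 1 0 * (edge y Z c \<sigma> b * BI_int (j + 1) \<sigma> y \<alpha> c W Z)"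
      by (simp only: mult_ac)
    then have "contig (j + 1) = edge y Z c \<sigma> b * BI_int (j + 1) \<sigma> y \<alpha> c W Z"
      using mult_left_cancel[OF kernj_up_neq_0[OF y(1) \<alpha> j, of W c \<sigma>]] by blast
    then show ?thesis unfolding Suc j_def by (simp add: add_ac)
  qed
qed

end

text \<open>Recurrence and contiguity relations in one formula. Since \<open>kern\<close> contains
  \<open>edge\<close> at \<open>(t, W)\<close>, the sum over \<open>a\<close> exchanges it for
  \<open>edge\<close> at \<open>(y, Z)\<close>: one step of the transfer-matrix induction.\<close>

theorem BI_contiguity:
  assumes "y > 0" "y + 2 * real_of_int b > 0" "\<alpha> > 1" "\<sigma> = 1 \<or> \<sigma> = -1" "b \<in> {-1, 0, 1}" "j \<ge> 0"
  shows "(\<Sum>a\<in>{-1, 0, 1}. kernj W c \<alpha> y \<sigma> j a b * BI_int (j + a - b) (\<sigma> * par b) (y + 2 * real_of_int b) \<alpha> c W Z)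
    = edge y Z c \<sigma> b * BI_int j \<sigma> y \<alpha> c W Z"
proof -
  have *: "(\<Sum>a\<in>{-1, 0, 1::int}. f a) = f 1 + f 0 + f (-1)" for f :: "int \<Rightarrow> real"
    by simp
  show ?thesis
  proof (cases "b = 0")
    case True
    then show ?thesis
      using BI_int_recurrence[of y \<alpha> \<sigma> j W c Z] assms unfolding * by (simp add: par_def)
  next
    case False
    then have "b = 1 \<or> b = -1" "par b = -1" using assms(5) by (auto simp: par_def)
    then show ?thesis
      using contig_eq[of y b \<alpha> \<sigma> c W Z "nat j"] assms unfolding * by (simp add: contig_def)
  qed
qed

section \<open>The eigenvalue equations\<close>

lemma powi_eq_par: "(-1::real) powi i = par i"
  by (cases "even i") (simp_all add: par_def)

lemma power_eq_par: "(-1::real) ^ m = par (int m)"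
  by (simp add: par_def)

lemma par_add: "par (i + j) = par i * par j"
  by (simp add: par_def)

lemma par_mult: "par (int m * int k) = par (int m) ^ k"
  by (cases "even m"; cases "even k") (simp_all add: par_def)

lemma asum_Suc: "i \<le> Suc j \<Longrightarrow> asum \<alpha> i (Suc j) = asum \<alpha> i j + \<alpha> (Suc j)"
  by (simp add: asum_def)

lemma asum_first: "1 \<le> j \<Longrightarrow> asum \<alpha> 1 j = \<alpha> 1 + asum \<alpha> 2 j"
  by (simp add: asum_def sum.atLeast_Suc_atMost numeral_2_eq_2)

lemma nsum_0 [simp]: "nsum n 0 = 0"
  by (simp add: nsum_def)

lemma nsum_step: "1 \<le> p \<Longrightarrow> nsum n p = nsum n (p - 1) + n p"
  by (cases p) (simp_all add: nsum_def)

text \<open>From \<open>m\<close> to \<open>m + 1\<close> the first product grows only for even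
  \<open>m\<close>, where its new numerator cancels the new factor of the even product. The
  Pochhammer factor times \<open>-8\<close> gives
  \<open>- 4 * (2 * m + y + \<alpha> + 1)\<close>.\<close>

lemma BI_scale_eq:
  assumes "\<alpha> > 1" "y > 0"
  shows "BI_scale m y \<alpha> = (\<Prod>l<m div 2 + m mod 2. (2 * real l + y + 1) / (2 * real l + \<alpha>)) *
      ((-8) ^ m * pochhammer ((y + \<alpha> + 1) / 2) m
       / ((\<Prod>l\<in>{l. l < m \<and> even l}. real l + y + 1) * (\<Prod>l\<in>{l. l < m \<and> odd l}. real l + y + \<alpha>)))"
proof (induction m)
  case 0
  then show ?case by (simp add: BI_scale_def)
next
  case (Suc m)
  have pos: "real l + y + 1 \<noteq> 0" "real l + y + \<alpha> \<noteq> 0" "real l + \<alpha> \<noteq> 0" for l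
    using assms by (simp_all add: add_nonneg_pos)
  define Ev Od where "Ev = (\<Prod>l\<in>{l. l < m \<and> even l}. real l + y + 1)"
    and "Od = (\<Prod>l\<in>{l. l < m \<and> odd l}. real l + y + \<alpha>)"
  have nz: "Ev \<noteq> 0" "Od \<noteq> 0"
    using pos by (simp_all add: Ev_def Od_def)
  show ?case
  proof (cases "even m")
    case True
    then have sets: "{l. l < Suc m \<and> even l} = insert m {l. l < m \<and> even l}"
        "{l. l < Suc m \<and> odd l} = {l. l < m \<and> odd l}"
      by (auto simp: less_Suc_eq)
    have half: "Suc m div 2 + Suc m mod 2 = Suc (m div 2 + m mod 2)" "2 * real (m div 2 + m mod 2) = real m"
      using True by (auto elim!: evenE)
    have prods: "(\<Prod>l\<in>{l. l < Suc m \<and> even l}. real l + y + 1) = (real m + y + 1) * Ev"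
        "(\<Prod>l\<in>{l. l < Suc m \<and> odd l}. real l + y + \<alpha>) = Od"
      unfolding sets Ev_def Od_def by simp_all
    show ?thesis
      using True pos[of m] nz unfolding prods half(1) prod.lessThan_Suc half(2)
        BI_scale_Suc Suc.IH Ev_def[symmetric] Od_def[symmetric] pochhammer_Suc
      by (simp add: divide_simps) (simp add: algebra_simps)
  next
    case False
    then have sets: "{l. l < Suc m \<and> odd l} = insert m {l. l < m \<and> odd l}"
        "{l. l < Suc m \<and> even l} = {l. l < m \<and> even l}"
      by (auto simp: less_Suc_eq)
    have half: "Suc m div 2 + Suc m mod 2 = m div 2 + m mod 2"
      using False by (auto elim!: oddE)
    have prods: "(\<Prod>l\<in>{l. l < Suc m \<and> odd l}. real l + y + \<alpha>) = (real m + y + \<alpha>) * Od"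
        "(\<Prod>l\<in>{l. l < Suc m \<and> even l}. real l + y + 1) = Ev"
      unfolding sets Ev_def Od_def by simp_all
    have "real m + \<alpha> + (if odd m then y else 0) = real m + y + \<alpha>" using False by simp
    then show ?thesis
      using pos[of m] nz unfolding prods half
        BI_scale_Suc Suc.IH Ev_def[symmetric] Od_def[symmetric] pochhammer_Suc
      by (simp add: divide_simps) (simp add: algebra_simps)
  qed
qed

section \<open>Sums over step vectors as transfer matrices\<close>

fun transfer :: "(int \<Rightarrow> real) \<Rightarrow> (nat \<Rightarrow> int \<Rightarrow> int \<Rightarrow> real) \<Rightarrow> nat \<Rightarrow> int \<Rightarrow> real"
  where
    "transfer g h 0 b = g b"
  | "transfer g h (Suc l) b = (\<Sum>a\<in>{-1, 0, 1}. transfer g h l a * h (Suc l) a b)"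

lemma step_vectors_0: "step_vectors 0 = {\<lambda>_. 0}"
  by (auto simp: step_vectors_def)

lemma step_vectors_Suc:
  "bij_betw (\<lambda>(a, \<nu>). \<nu>(Suc j := a)) ({-1, 0, 1} \<times> step_vectors j) (step_vectors (Suc j))"
proof (rule bij_betw_byWitness[where f' = "\<lambda>\<nu>. (\<nu> (Suc j), \<nu>(Suc j := 0))"])
  show "\<forall>p\<in>{-1, 0, 1} \<times> step_vectors j.
      (\<lambda>\<nu>. (\<nu> (Suc j), \<nu>(Suc j := 0))) ((\<lambda>(a, \<nu>). \<nu>(Suc j := a)) p) = p"
    by (auto simp: step_vectors_def fun_eq_iff)
qed (auto simp: step_vectors_def le_Suc_eq)

text \<open>The update at \<open>Suc j\<close> supplies the entry after the summed ones; for
  \<open>j = 0\<close> it becomes the argument of \<open>g\<close>. The induction splits off the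
  last entry.\<close>

lemma sum_step_vectors:
  "(\<Sum>\<nu>\<in>step_vectors j. g ((\<nu>(Suc j := b)) 1) * (\<Prod>l = 1..j. h l (\<nu> l) ((\<nu>(Suc j := b)) (Suc l))))
    = transfer g h j b"
proof (induction j arbitrary: b)
  case 0
  then show ?case by (simp add: step_vectors_0)
next
  case (Suc j)
  let ?t = "\<lambda>j b \<nu>. g ((\<nu>(Suc j := b)) 1) * (\<Prod>l = 1..j. h l (\<nu> l) ((\<nu>(Suc j := b)) (Suc l)))"
  have split: "?t (Suc j) b (\<nu>(Suc j := a)) = ?t j a \<nu> * h (Suc j) a b" for a \<nu>
  proof -
    have "(\<Prod>l = 1..j. h l ((\<nu>(Suc j := a)) l) (((\<nu>(Suc j := a))(Suc (Suc j) := b)) (Suc l)))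
        = (\<Prod>l = 1..j. h l (\<nu> l) ((\<nu>(Suc j := a)) (Suc l)))"
      by (rule prod.cong) auto
    then show ?thesis by simp
  qed
  have "(\<Sum>\<nu>\<in>step_vectors (Suc j). ?t (Suc j) b \<nu>)
      = (\<Sum>(a, \<nu>)\<in>{-1, 0, 1} \<times> step_vectors j. ?t (Suc j) b (\<nu>(Suc j := a)))"
    by (subst sum.reindex_bij_betw[OF step_vectors_Suc, symmetric]) (simp add: case_prod_beta)
  also have "\<dots> = (\<Sum>a\<in>{-1, 0, 1}. (\<Sum>\<nu>\<in>step_vectors j. ?t j a \<nu>) * h (Suc j) a b)"
    unfolding split by (simp only: sum.cartesian_product[symmetric] sum_distrib_right)
  finally show ?case by (simp only: Suc.IH transfer.simps)
qed

section \<open>Factorization of the renormalized polynomials\<close>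

locale BI_parameters =
  fixes s N :: nat and \<alpha> :: "nat \<Rightarrow> real" and \<beta> :: real
  assumes \<beta>: "\<beta> > 0" and \<alpha>: "\<And>i. 2 \<le> i \<Longrightarrow> i \<le> s + 1 \<Longrightarrow> \<alpha> i > 1"
    and \<alpha>1: "\<alpha> 1 - 1 > \<beta>"
begin

text \<open>The coordinate \<open>W\<close> or \<open>Z\<close> of the univariate relations. The
  update sets the value at \<open>s + 1\<close> to \<open>N\<close>, so the last factor has the same
  form as the others.\<close>

definition node :: "(nat \<Rightarrow> int) \<Rightarrow> nat \<Rightarrow> real"
  where "node x k = (let y = (x(s + 1 := int N)) k in par y * (real_of_int y + asum \<alpha> 1 k / 2))"

text \<open>The coordinate \<open>y\<close> at level \<open>p\<close>; \<open>base (p + 1)\<close>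
  at the next partial sum is the coordinate \<open>t\<close>.\<close>

definition base :: "nat \<Rightarrow> real \<Rightarrow> real"
  where "base p M = 2 * M + asum \<alpha> 2 p + \<beta>"

definition factor :: "(nat \<Rightarrow> int) \<Rightarrow> nat \<Rightarrow> int \<Rightarrow> int \<Rightarrow> real"
  where "factor x p j M = BI_int j (par M) (base p (real_of_int M)) (\<alpha> (p + 1)) (\<beta> - \<alpha> 1 + 1) (node x (p + 1)) (node x p)"

text \<open>The part of \<open>norm_k\<close> that depends only on the total degree; the rest is
  distributed over the factors.\<close>

definition gauge :: "nat \<Rightarrow> real"
  where "gauge M = par (int M * int N) / (\<Prod>l<M.
           - (2 * real l + 2 * real N + \<alpha> 1 + 2 * asum \<alpha> 2 (s+1) + \<beta> + 1)
             + (-1) ^ (N + l) * (\<alpha> 1 - \<beta> - 1))"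

lemma asum_2_nonneg: "p \<le> s + 1 \<Longrightarrow> asum \<alpha> 2 p \<ge> 0"
  unfolding asum_def by (rule sum_nonneg) (use \<alpha> in \<open>force intro: less_imp_le less_trans[OF zero_less_one]\<close>)

lemma base_pos: "p \<le> s + 1 \<Longrightarrow> M \<ge> 0 \<Longrightarrow> base p M > 0"
  using asum_2_nonneg[of p] \<beta> by (simp add: base_def)

text \<open>For the two signs the value is \<open>-2\<close> times
  \<open>l + N + asum \<alpha> 2 (s+1) + \<beta> + 1\<close> or
  \<open>l + N + \<alpha> 1 + asum \<alpha> 2 (s+1)\<close>.\<close>

lemma gauge_denominator_neg:
  "- (2 * real l + 2 * real N + \<alpha> 1 + 2 * asum \<alpha> 2 (s+1) + \<beta> + 1) + (-1) ^ (N + l) * (\<alpha> 1 - \<beta> - 1) < 0"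
  using asum_2_nonneg[of "s + 1"] \<beta> \<alpha>1 by (cases "even (N + l)") simp_all

lemma gauge_neq_0: "gauge M \<noteq> 0"
proof -
  have "(\<Prod>l<M. - (2 * real l + 2 * real N + \<alpha> 1 + 2 * asum \<alpha> 2 (s+1) + \<beta> + 1)
             + (-1) ^ (N + l) * (\<alpha> 1 - \<beta> - 1)) \<noteq> 0"
    using gauge_denominator_neg by (simp add: less_imp_neq)
  then show ?thesis by (simp add: gauge_def par_def)
qed

lemma factor_eq:
  assumes "1 \<le> k" "k \<le> s"
  shows "factor x k (int (n k)) (int (nsum n (k - 1))) = par (int (n k * nsum n (k - 1)))
    * (norm_eta \<alpha> \<beta> n k * norm_theta \<alpha> \<beta> n k)
    * (let y = x(s+1 := int N); M = nsum n (k-1);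
           X = (-1) powi (int M + y (k+1)) / 2 * (real_of_int (y (k+1)) + asum \<alpha> 1 (k+1) / 2)
       in BI_poly (n k)
            ((-1) powi (int M + y k) / 2 * (real_of_int (y k) + asum \<alpha> 1 k / 2) - 1/4)
            (real M / 2 + (asum \<alpha> 1 k - 1) / 4)
            (X + (\<alpha> (k+1) - 1) / 4)
            (X - (\<alpha> (k+1) - 1) / 4)
            (- (real M / 2) + (\<alpha> 1 - asum \<alpha> 2 k - 1) / 4 - \<beta> / 2))"
proof -
  define M where "M = nsum n (k - 1)"
  have pos: "base k (real M) > 0" "\<alpha> (k + 1) > 1"
    using base_pos[of k "real M"] \<alpha>[of "k + 1"] assms by simp_all
  have asum: "asum \<alpha> 2 (k + 1) = asum \<alpha> 2 k + \<alpha> (k + 1)" "asum \<alpha> 1 k = \<alpha> 1 + asum \<alpha> 2 k"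
    using assms asum_first[of k \<alpha>] by (simp_all add: asum_Suc)
  have scale: "BI_scale (n k) (base k (real M)) (\<alpha> (k + 1)) = norm_eta \<alpha> \<beta> n k * norm_theta \<alpha> \<beta> n k"
  proof -
    have poch: "real M + (asum \<alpha> 2 k + \<alpha> (k + 1) + \<beta> + 1) / 2 = (base k (real M) + \<alpha> (k + 1) + 1) / 2"
      by (simp add: base_def field_simps)
    show ?thesis
      unfolding BI_scale_eq[OF pos(2,1)] norm_eta_def norm_theta_def M_def[symmetric] Let_def asum poch
      by (simp add: base_def add_ac)
  qed
  have sign: "par (int M) ^ n k = par (int (n k * M))"
    by (simp only: par_mult[symmetric] of_nat_mult mult.commute)
  have args: "(base k (real M) - (\<beta> - \<alpha> 1 + 1)) / 4 = real M / 2 + (asum \<alpha> 1 k - 1) / 4"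
    "- (base k (real M) + (\<beta> - \<alpha> 1 + 1)) / 4 = - (real M / 2) + (\<alpha> 1 - asum \<alpha> 2 k - 1) / 4 - \<beta> / 2"
    unfolding asum by (simp_all add: base_def field_simps)
  have mult: "par (int M) * node x i / 2 = (-1) powi (int M + (x(s+1 := int N)) i) / 2
      * (real_of_int ((x(s+1 := int N)) i) + asum \<alpha> 1 i / 2)" for i
    by (simp add: node_def Let_def powi_eq_par par_add)
  show ?thesis
    unfolding factor_def BI_int_def BI_fun_def M_def[symmetric] Let_def
    by (simp only: nat_int of_int_of_nat_eq scale sign args mult of_nat_0_le_iff not_less if_False)
      simp
qed

lemma renorm_BI_eq:
  "renorm_BI s \<alpha> \<beta> N n x = gauge (nsum n s) * (\<Prod>p = 1..s. factor x p (int (n p)) (int (nsum n (p - 1))))"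
proof -
  have sign: "(\<Prod>p = 1..s. par (int (n p * nsum n (p - 1)))) = (-1) ^ (\<Sum>k = 2..s. n k * nsum n (k - 1))"
  proof -
    \<comment> \<open>The index 1 contributes no sign because \<open>nsum n 0 = 0\<close>.\<close>
    have "(\<Prod>p = 1..s. par (int (n p * nsum n (p - 1)))) = (\<Prod>p = 2..s. par (int (n p * nsum n (p - 1))))"
    proof (cases "s \<ge> 1")
      case True
      have "par 0 = 1" by (simp add: par_def)
      then show ?thesis by (subst prod.atLeast_Suc_atMost[OF True]) (simp add: numeral_2_eq_2)
    qed simp
    then show ?thesis by (simp only: power_sum power_eq_par[symmetric])
  qed
  have "(\<Prod>p = 1..s. factor x p (int (n p)) (int (nsum n (p - 1))))
    = (-1) ^ (\<Sum>k = 2..s. n k * nsum n (k - 1)) * (\<Prod>k = 1..s. norm_eta \<alpha> \<beta> n k * norm_theta \<alpha> \<beta> n k)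
      * multi_BI s \<alpha> \<beta> N n x"
    unfolding multi_BI_def Let_def sign[symmetric] prod.distrib[symmetric]
    by (rule prod.cong[OF refl]) (simp only: factor_eq[unfolded Let_def] atLeastAtMost_iff)
  then show ?thesis
    by (simp add: renorm_BI_def norm_k_def gauge_def power_add power_eq_par)
qed

section \<open>Transfer-matrix evaluation of the operators\<close>

definition top_layer :: "(nat \<Rightarrow> nat) \<Rightarrow> int \<Rightarrow> real"
  where "top_layer n b = coeff_E0 s \<alpha> \<beta> N n b * gauge (nat (int (nsum n s) + b))"

text \<open>Shifting the partial sums at \<open>p\<close> and \<open>p - 1\<close> by
  \<open>a\<close> and \<open>b\<close>, where \<open>p = s - l + 1\<close>, shifts
  \<open>n p\<close> by \<open>a - b\<close>.\<close>

definition layer :: "(nat \<Rightarrow> int) \<Rightarrow> (nat \<Rightarrow> nat) \<Rightarrow> nat \<Rightarrow> int \<Rightarrow> int \<Rightarrow> real"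
  where "layer x n l a b = coeff_E s \<alpha> \<beta> n l a b / coeff_e s \<alpha> \<beta> n l a
    * factor x (s - l + 1) (int (n (s - l + 1)) + a - b) (int (nsum n (s - l)) + b)"

text \<open>The ratio of the gauges absorbs the boundary coefficient: for \<open>b = 1\<close> the
  coefficient is half the next denominator factor, and for \<open>b = -1\<close> its product with
  the preceding factor is the quadratic \<open>edge\<close> value.\<close>

lemma top_layer_eq:
  assumes "b \<in> {-1, 0, 1}" "int (nsum n s) + b \<ge> 0"
  shows "top_layer n b = par (int N) * gauge (nsum n s)
    * edge (base (s + 1) (real (nsum n s))) (node x (s + 1)) (\<beta> - \<alpha> 1 + 1) (par (int (nsum n s))) b"
proof -
  define M where "M = nsum n s"
  have A: "asum \<alpha> 1 (s + 1) = \<alpha> 1 + asum \<alpha> 2 (s + 1)" by (rule asum_first) simp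
  define q where "q l = - (2 * real l + 2 * real N + \<alpha> 1 + 2 * asum \<alpha> 2 (s+1) + \<beta> + 1)
             + (-1) ^ (N + l) * (\<alpha> 1 - \<beta> - 1)" for l
  have q: "q l \<noteq> 0" for l using gauge_denominator_neg[of l] by (simp add: q_def)
  have gauge_Suc: "gauge (Suc l) * q l = par (int N) * gauge l" for l
  proof -
    have "gauge m = par (int m * int N) / (\<Prod>l<m. q l)" for m by (simp only: gauge_def q_def)
    moreover have "par (int (Suc l) * int N) = par (int N) * par (int l * int N)"
      by (simp add: par_add[symmetric] distrib_right)
    ultimately show ?thesis using q[of l] by simp
  qed
  have gauge_up: "gauge (Suc l) = par (int N) * gauge l / q l" for l
    using gauge_Suc[of l] q[of l] by (simp add: field_simps)
  have gauge_down: "gauge l = par (int N) * gauge (Suc l) * q l" for l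
    using gauge_Suc[of l] by (simp add: par_def mult_ac split: if_splits)
  have parN: "par (int N) * par (int N) = 1" by (simp add: par_def)
  consider "b = 0" | "b = 1" | l where "b = -1" "M = Suc l"
    using assms unfolding M_def[symmetric] by (cases M) auto
  then show ?thesis
  proof cases
    case 1
    then show ?thesis unfolding top_layer_def M_def[symmetric] coeff_E0_def Let_def edge_def base_def node_def A
      by (cases "even N"; cases "even M") (simp_all add: par_def field_simps)
  next
    case 2
    have coeff: "coeff_E0 s \<alpha> \<beta> N n 1 = q M / 2"
      unfolding coeff_E0_def Let_def q_def A M_def[symmetric]
      by (cases "even N"; cases "even M") (simp_all add: powi_eq_par par_def field_simps)
    have suc: "nat (int M + 1) = Suc M" by simp
    show ?thesis unfolding top_layer_def M_def[symmetric] 2 coeff suc gauge_up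
      using q[of M] by (simp add: edge_def)
  next
    case 3
    have pred: "nat (int M + -1) = l" using 3 by simp
    have coeff: "coeff_E0 s \<alpha> \<beta> N n (-1) * q l
      = edge (base (s + 1) (real M)) (node x (s + 1)) (\<beta> - \<alpha> 1 + 1) (par (int M)) (-1)"
      unfolding coeff_E0_def Let_def q_def A M_def[symmetric] edge_def base_def node_def 3
      by (cases "even N"; cases "even l") (simp_all add: powi_eq_par par_def field_simps power2_eq_square)
    show ?thesis unfolding top_layer_def M_def[symmetric] 3(1) pred coeff[symmetric]
      unfolding gauge_down[of l] 3(2) by simp
  qed
qed

lemma layer_eq:
  assumes "1 \<le> p" "p \<le> s" "a \<in> {-1, 0, 1}" "b \<in> {-1, 0, 1}"
  shows "edge (base (p + 1) (real (nsum n p))) (node x (p + 1)) (\<beta> - \<alpha> 1 + 1) (par (int (nsum n p))) a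
      * layer x n (s - p + 1) a b
    = kernj (node x (p + 1)) (\<beta> - \<alpha> 1 + 1) (\<alpha> (p + 1)) (base p (real (nsum n (p - 1))))
        (par (int (nsum n (p - 1)))) (int (n p)) a b
      * BI_int (int (n p) + a - b) (par (int (nsum n (p - 1))) * par b)
          (base p (real (nsum n (p - 1))) + 2 * real_of_int b) (\<alpha> (p + 1)) (\<beta> - \<alpha> 1 + 1) (node x (p + 1)) (node x p)"
proof -
  define M where "M = nsum n (p - 1)"
  define t where "t = base (p + 1) (real (nsum n p))"
  have p: "s - (s - p + 1) + 1 = p" "s - (s - p + 1) = p - 1" using assms by simp_all
  have N: "nsum n p = M + n p" using nsum_step[OF assms(1)] by (simp add: M_def)
  have t_eq: "2 * real_of_int (int (n p)) + base p (real M) + \<alpha> (p + 1) = t"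
    using assms by (simp add: t_def base_def N asum_Suc)
  have asum: "asum \<alpha> 2 (p + 1) = asum \<alpha> 2 p + \<alpha> (p + 1)" using assms by (simp add: asum_Suc)
  have E: "coeff_E s \<alpha> \<beta> n (s - p + 1) a b = stepE t (base p (real M)) (\<alpha> (p + 1)) (par (int (n p))) a b"
    unfolding coeff_E_def Let_def stepE_def p(1) M_def[symmetric] t_def base_def N asum power_eq_par
    using assms(3,4) unfolding insert_iff empty_iff by (elim disjE) (simp_all add: algebra_simps)
  have e: "coeff_e s \<alpha> \<beta> n (s - p + 1) a = stepe t a"
    unfolding coeff_e_def Let_def stepe_def p(1) t_def base_def by (simp add: algebra_simps)
  have shift: "base p (real_of_int (int M + b)) = base p (real M) + 2 * real_of_int b"
    by (simp add: base_def)
  have par: "par (int (nsum n p)) = par (int M) * par (int (n p))" by (simp add: N par_add)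
  show ?thesis
    unfolding layer_def E e
    unfolding p(1)
    unfolding p(2) factor_def kernj_def kern_def M_def[symmetric] t_def[symmetric] t_eq shift par
    by (simp add: par_add)
qed

text \<open>Each use of \<open>BI_contiguity\<close> turns \<open>edge\<close> at level
  \<open>p + 1\<close> into \<open>edge\<close> at level \<open>p\<close> and releases the factor of
  level \<open>p\<close>.\<close>

lemma transfer_eq:
  assumes "l \<le> s" "b \<in> {-1, 0, 1}" "int (nsum n (s - l)) + b \<ge> 0"
  shows "transfer (top_layer n) (layer x n) l b = par (int N) * gauge (nsum n s)
    * (\<Prod>p = s - l + 1..s. factor x p (int (n p)) (int (nsum n (p - 1))))
    * edge (base (s - l + 1) (real (nsum n (s - l)))) (node x (s - l + 1)) (\<beta> - \<alpha> 1 + 1)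
        (par (int (nsum n (s - l)))) b"
  using assms
proof (induction l arbitrary: b)
  case 0
  then show ?case using top_layer_eq[of b n] by simp
next
  case (Suc l)
  define p where "p = s - l"
  have p: "1 \<le> p" "p \<le> s" "s - l = p" "s - Suc l = p - 1" "s - l + 1 = p + 1" "s - Suc l + 1 = p" "Suc l = s - p + 1"
    using Suc.prems(1) by (auto simp: p_def)
  define c where "c = \<beta> - \<alpha> 1 + 1"
  define M where "M = nsum n (p - 1)"
  define K where "K = par (int N) * gauge (nsum n s) * (\<Prod>p = p + 1..s. factor x p (int (n p)) (int (nsum n (p - 1))))"
  have N: "nsum n p = M + n p" using nsum_step[OF p(1)] by (simp add: M_def)
  have summand: "transfer (top_layer n) (layer x n) l a * layer x n (Suc l) a b
    = K * (kernj (node x (p + 1)) c (\<alpha> (p + 1)) (base p (real M)) (par (int M)) (int (n p)) a b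
      * BI_int (int (n p) + a - b) (par (int M) * par b)
          (base p (real M) + 2 * real_of_int b) (\<alpha> (p + 1)) c (node x (p + 1)) (node x p))"
    if a: "a \<in> {-1, 0, 1}" for a
  proof (cases "int (nsum n p) + a \<ge> 0")
    case True
    have IH: "transfer (top_layer n) (layer x n) l a
      = K * edge (base (p + 1) (real (nsum n p))) (node x (p + 1)) (\<beta> - \<alpha> 1 + 1) (par (int (nsum n p))) a"
      using Suc.IH[of a] Suc.prems(1) a True unfolding p(3,5) K_def by simp
    show ?thesis
      unfolding IH c_def M_def mult.assoc layer_eq[OF p(1,2) a Suc.prems(2), of n, folded p(7)] by (rule refl)
  next
    \<comment> \<open>A negative partial sum is outside the induction hypothesis. Here
      \<open>n p\<close> and \<open>M\<close> are 0 and \<open>a = -1\<close>, so both sides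
      vanish.\<close>
    case False
    have np: "n p = 0" "M = 0" and an: "a = -1" using False a N by auto
    then have "b \<ge> 0" using Suc.prems(3) unfolding p(4) M_def by auto
    then have vanish: "kernj W c' \<alpha>' y \<sigma> (int (n p)) a b = 0" for W c' \<alpha>' y \<sigma>
      using kernj_eq_0[of "int (n p)" a b] a Suc.prems(2) np an by auto
    have "coeff_E s \<alpha> \<beta> n (Suc l) a b = 0"
      using np an \<open>b \<ge> 0\<close> Suc.prems(2) p N unfolding coeff_E_def Let_def p(7)
      by (auto simp: M_def asum_Suc)
    then show ?thesis by (simp add: vanish layer_def)
  qed
  have pos: "base p (real M) > 0" using base_pos[of p "real M"] p by simp
  have pos': "base p (real M) + 2 * real_of_int b > 0"
    using base_pos[of p "real M + real_of_int b"] p Suc.prems(3) unfolding p(4) M_def[symmetric]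
    by (simp add: base_def)
  have "transfer (top_layer n) (layer x n) (Suc l) b = K * (\<Sum>a\<in>{-1, 0, 1}.
      kernj (node x (p + 1)) c (\<alpha> (p + 1)) (base p (real M)) (par (int M)) (int (n p)) a b
      * BI_int (int (n p) + a - b) (par (int M) * par b)
          (base p (real M) + 2 * real_of_int b) (\<alpha> (p + 1)) c (node x (p + 1)) (node x p))"
    unfolding transfer.simps sum_distrib_left by (rule sum.cong[OF refl]) (rule summand)
  also have "\<dots> = K * (edge (base p (real M)) (node x p) c (par (int M)) b * factor x p (int (n p)) (int M))"
    using BI_contiguity[OF pos pos' \<alpha>[of "p + 1"] par_cases[of "int M"] Suc.prems(2), where j = "int (n p)"] p
    unfolding factor_def c_def[symmetric] by simp
  also have "\<dots> = par (int N) * gauge (nsum n s)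
    * (\<Prod>p = p..s. factor x p (int (n p)) (int (nsum n (p - 1)))) * edge (base p (real M)) (node x p) c (par (int M)) b"
    using p by (subst prod.atLeast_Suc_atMost[of p s]) (simp_all add: K_def M_def)
  finally show ?case unfolding p(6) unfolding p(4) c_def M_def .
qed

text \<open>Shifts move each partial sum by one entry of \<open>\<nu>\<close>, so every term is a
  product over layers. For a negative shifted index the omitted term matches a product containing a
  zero value of \<open>BI_int\<close>.\<close>

lemma shift_op_renorm_BI:
  assumes j: "j \<le> s" and \<nu>: "\<nu> \<in> step_vectors j"
  shows "coeff_D s \<alpha> \<beta> N j \<nu> n * shift_op s j \<nu> (\<lambda>m. renorm_BI s \<alpha> \<beta> N m x) n
    = top_layer n (\<nu> 1) * (\<Prod>l = 1..j. layer x n l (\<nu> l) (\<nu> (Suc l)))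
      * (\<Prod>p = 1..s - j. factor x p (int (n p)) (int (nsum n (p - 1))))"
proof -
  have \<nu>0: "\<nu> l = 0" if "l \<notin> {1..j}" for l using \<nu> that by (auto simp: step_vectors_def)
  define \<phi> where "\<phi> l = factor x (s - l + 1) (int (n (s - l + 1)) + \<nu> l - \<nu> (Suc l)) (int (nsum n (s - l)) + \<nu> (Suc l))" for l
  have layers: "(\<Prod>l = 1..j. layer x n l (\<nu> l) (\<nu> (Suc l)))
    = (\<Prod>l = 1..j. coeff_E s \<alpha> \<beta> n l (\<nu> l) (\<nu> (l + 1))) / (\<Prod>l = 1..j. coeff_e s \<alpha> \<beta> n l (\<nu> l)) * (\<Prod>l = 1..j. \<phi> l)"
    by (simp add: layer_def \<phi>_def prod.distrib prod_dividef)
  show ?thesis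
  proof (cases "\<forall>i. 0 \<le> shifted_index s j \<nu> n i")
    case False
    then obtain i where i: "shifted_index s j \<nu> n i < 0" by (meson not_le)
    then have mem: "i \<in> {s - j + 1..s}" by (auto simp: shifted_index_def split: if_splits)
    have l: "s - (s - i + 1) + 1 = i" "s - i + 1 \<in> {1..j}" "Suc (s - i + 1) = s - i + 2" using mem by auto
    have "\<phi> (s - i + 1) = 0"
      using i mem unfolding \<phi>_def l(1) by (simp add: shifted_index_def factor_def BI_int_def)
    then have "(\<Prod>l = 1..j. \<phi> l) = 0" using l(2) by (meson finite_atLeastAtMost prod_zero)
    moreover have "shift_op s j \<nu> (\<lambda>m. renorm_BI s \<alpha> \<beta> N m x) n = 0"
      using False unfolding shift_op_def by (simp only: if_False)
    ultimately show ?thesis by (simp only: layers mult_zero_left mult_zero_right)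
  next
    case True
    define n' where "n' i = nat (shifted_index s j \<nu> n i)" for i
    have n': "int (n' i) = (if i \<in> {s-j+1..s} then int (n i) + \<nu> (s-i+1) - \<nu> (s-i+2) else int (n i))" for i
      using True unfolding n'_def by (simp add: shifted_index_def)
    have low: "n' i = n i" if "i \<le> s - j" for i using n'[of i] that by simp
    have nsum_low: "nsum n' p = nsum n p" if "p \<le> s - j" for p
      unfolding nsum_def using low that by (intro sum.cong) auto
    \<comment> \<open>The shifts telescope, starting from \<open>\<nu> (j + 1) = 0\<close>.\<close>
    have nsum_high: "int (nsum n' (s - j + k)) = int (nsum n (s - j + k)) + \<nu> (j - k + 1)" if "k \<le> j" for k
      using that
    proof (induction k)
      case 0
      then show ?case using nsum_low[of "s - j"] \<nu>0[of "Suc j"] by simp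
    next
      case (Suc k)
      have "nsum m (s - j + Suc k) = nsum m (s - j + k) + m (s - j + Suc k)" for m
        using nsum_step[of "s - j + Suc k" m] by simp
      moreover have "int (n' (s - j + Suc k)) = int (n (s - j + Suc k)) + \<nu> (j - Suc k + 1) - \<nu> (j - k + 1)"
      proof -
        have "s - (s - j + Suc k) + 1 = j - Suc k + 1" "s - (s - j + Suc k) + 2 = j - k + 1"
          "s - j + Suc k \<in> {s - j + 1..s}"
          using Suc.prems j by auto
        then show ?thesis unfolding n' by presburger
      qed
      ultimately show ?case using Suc.IH Suc.prems by simp
    qed
    have nsum_s: "int (nsum n' s) = int (nsum n s) + \<nu> 1" using nsum_high[of j] j by simp
    have factor_high: "factor x (s - l + 1) (int (n' (s - l + 1))) (int (nsum n' (s - l + 1 - 1))) = \<phi> l" if l: "l \<in> {1..j}" for l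
    proof -
      have l': "s - j + (j - l) = s - l" "j - (j - l) + 1 = Suc l" "s - l + 1 - 1 = s - l"
        using l j by auto
      have "int (n' (s - l + 1)) = int (n (s - l + 1)) + \<nu> l - \<nu> (Suc l)"
      proof -
        have "s - (s - l + 1) + 1 = l" "s - (s - l + 1) + 2 = Suc l" "s - l + 1 \<in> {s - j + 1..s}"
          using l j by auto
        then show ?thesis unfolding n' by presburger
      qed
      then show ?thesis
        using nsum_high[of "j - l"] unfolding l' by (simp add: \<phi>_def)
    qed
    have "(\<Prod>p = 1..s. factor x p (int (n' p)) (int (nsum n' (p - 1))))
      = (\<Prod>p = 1..s - j. factor x p (int (n' p)) (int (nsum n' (p - 1))))
        * (\<Prod>p = s - j + 1..s. factor x p (int (n' p)) (int (nsum n' (p - 1))))"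
      using prod.ub_add_nat[of 1 "s - j" "\<lambda>p. factor x p (int (n' p)) (int (nsum n' (p - 1)))" j] j by simp
    also have "(\<Prod>p = 1..s - j. factor x p (int (n' p)) (int (nsum n' (p - 1))))
      = (\<Prod>p = 1..s - j. factor x p (int (n p)) (int (nsum n (p - 1))))"
      by (rule prod.cong[OF refl]) (auto simp: low nsum_low)
    also have "(\<Prod>p = s - j + 1..s. factor x p (int (n' p)) (int (nsum n' (p - 1)))) = (\<Prod>l = 1..j. \<phi> l)"
    proof (rule prod.reindex_bij_witness[of _ "\<lambda>l. s - l + 1" "\<lambda>p. s - p + 1"])
      fix p assume "p \<in> {s - j + 1..s}"
      then have "s - p + 1 \<in> {1..j}" "s - (s - p + 1) + 1 = p" using j by auto
      then show "\<phi> (s - p + 1) = factor x p (int (n' p)) (int (nsum n' (p - 1)))"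
        using factor_high[of "s - p + 1"] by metis
    qed (use j in auto)
    finally have "renorm_BI s \<alpha> \<beta> N n' x = gauge (nat (int (nsum n s) + \<nu> 1))
        * ((\<Prod>p = 1..s - j. factor x p (int (n p)) (int (nsum n (p - 1)))) * (\<Prod>l = 1..j. \<phi> l))"
      unfolding renorm_BI_eq nsum_s[symmetric] nat_int by simp
    moreover have "shift_op s j \<nu> (\<lambda>m. renorm_BI s \<alpha> \<beta> N m x) n = renorm_BI s \<alpha> \<beta> N n' x"
      using True by (simp add: shift_op_def n'_def[abs_def])
    ultimately show ?thesis
      unfolding layers coeff_D_def top_layer_def by (simp add: mult_ac)
  qed
qed

theorem BI_op_renorm_BI:
  assumes j: "j \<in> {1..s}"
  shows "BI_op s \<alpha> \<beta> N j (\<lambda>m. renorm_BI s \<alpha> \<beta> N m x) n = BI_eigenvalue s \<alpha> N x j * renorm_BI s \<alpha> \<beta> N n x"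
proof -
  define F where "F p = factor x p (int (n p)) (int (nsum n (p - 1)))" for p
  have "(\<Sum>\<nu>\<in>step_vectors j. coeff_D s \<alpha> \<beta> N j \<nu> n * shift_op s j \<nu> (\<lambda>m. renorm_BI s \<alpha> \<beta> N m x) n)
    = (\<Sum>\<nu>\<in>step_vectors j. top_layer n (\<nu> 1) * (\<Prod>l = 1..j. layer x n l (\<nu> l) (\<nu> (Suc l)))) * prod F {1..s - j}"
    unfolding sum_distrib_right F_def using j by (intro sum.cong[OF refl] shift_op_renorm_BI) auto
  also have "(\<Sum>\<nu>\<in>step_vectors j. top_layer n (\<nu> 1) * (\<Prod>l = 1..j. layer x n l (\<nu> l) (\<nu> (Suc l))))
      = transfer (top_layer n) (layer x n) j 0"
  proof -
    have "\<nu>(Suc j := 0) = \<nu>" if "\<nu> \<in> step_vectors j" for \<nu>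
      using that by (auto simp: step_vectors_def)
    then show ?thesis unfolding sum_step_vectors[symmetric] by (intro sum.cong[OF refl]) simp
  qed
  also have "transfer (top_layer n) (layer x n) j 0 * prod F {1..s - j}
      = par (int N) * edge (base (s - j + 1) (real (nsum n (s - j)))) (node x (s - j + 1)) (\<beta> - \<alpha> 1 + 1)
        (par (int (nsum n (s - j)))) 0 * renorm_BI s \<alpha> \<beta> N n x"
  proof -
    have "prod F {1..s} = prod F {1..s - j} * prod F {s - j + 1..s}"
      using prod.ub_add_nat[of 1 "s - j" F j] j by simp
    then have "renorm_BI s \<alpha> \<beta> N n x = gauge (nsum n s) * (prod F {1..s - j} * prod F {s - j + 1..s})"
      unfolding renorm_BI_eq F_def by simp
    then show ?thesis using transfer_eq[of j 0 n] j unfolding F_def by simp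
  qed
  finally have sum: "(\<Sum>\<nu>\<in>step_vectors j. coeff_D s \<alpha> \<beta> N j \<nu> n * shift_op s j \<nu> (\<lambda>m. renorm_BI s \<alpha> \<beta> N m x) n) = \<dots>" .
  \<comment> \<open>As \<open>j \<ge> 1\<close>, the index is at most \<open>s\<close>, so the value
    comes from \<open>x\<close> and not from \<open>N\<close>.\<close>
  have node: "node x (s - j + 1) = par (x (s - j + 1)) * (real_of_int (x (s - j + 1)) + asum \<alpha> 1 (s - j + 1) / 2)"
    using j by (auto simp: node_def Let_def)
  \<comment> \<open>The part of \<open>edge\<close> without \<open>node\<close> cancels the scalar
    term of the operator containing \<open>nsum n (s - j)\<close>.\<close>
  show ?thesis
    unfolding BI_op_def sum BI_eigenvalue_def node edge_def base_def power_eq_par powi_eq_par of_nat_add par_add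
    by (simp add: field_simps)
qed

end

section \<open>Linear independence and commutation\<close>

lemma BI_poly_is_monic_poly:
  "\<exists>p. degree p = m \<and> p \<noteq> 0 \<and> (\<forall>x. poly p x = BI_poly m x \<rho>1 \<rho>2 r1 r2)"
proof -
  have "\<exists>p. degree p = m \<and> lead_coeff p = 1 \<and> (\<forall>x. poly p x = BI_poly m x \<rho>1 \<rho>2 r1 r2)"
  proof (induction m rule: less_induct)
    case (less m)
    consider "m = 0" | "m = Suc 0" | k where "m = Suc (Suc k)"
      by (cases m; cases "m - 1") auto
    then show ?case
    proof cases
      case 1
      then show ?thesis by (intro exI[of _ 1]) simp
    next
      case 2
      then show ?thesis
        by (intro exI[of _ "[:- (\<rho>1 - BI_A \<rho>1 \<rho>2 r1 r2 0 - BI_C \<rho>1 \<rho>2 r1 r2 0), 1:]"]) simp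
    next
      case (3 k)
      obtain p where p: "degree p = Suc k" "lead_coeff p = 1" "\<forall>x. poly p x = BI_poly (Suc k) x \<rho>1 \<rho>2 r1 r2"
        using less[of "Suc k"] 3 by auto
      obtain q where q: "degree q = k" "lead_coeff q = 1" "\<forall>x. poly q x = BI_poly k x \<rho>1 \<rho>2 r1 r2"
        using less[of k] 3 by auto
      define l where "l = [:- (\<rho>1 - BI_A \<rho>1 \<rho>2 r1 r2 (Suc k) - BI_C \<rho>1 \<rho>2 r1 r2 (Suc k)), 1:]"
      define r where "r = smult (BI_A \<rho>1 \<rho>2 r1 r2 k * BI_C \<rho>1 \<rho>2 r1 r2 (Suc k)) q"
      have "degree (l * p) = Suc (Suc k)"
        using p(1,2) by (subst degree_mult_eq) (auto simp: l_def)
      moreover have "degree r < Suc (Suc k)"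
        using q(1) degree_smult_le[of _ q] unfolding r_def by (meson le_imp_less_Suc le_SucI order.trans order_refl)
      moreover have "lead_coeff (l * p) = 1" unfolding lead_coeff_mult p(2) by (simp add: l_def)
      ultimately have "degree (l * p - r) = Suc (Suc k)" "coeff (l * p - r) (Suc (Suc k)) = 1"
        using degree_add_eq_left[of "- r" "l * p"] coeff_eq_0[of r "Suc (Suc k)"] by simp_all
      moreover have "poly (l * p - r) x = BI_poly m x \<rho>1 \<rho>2 r1 r2" for x
        using p(3) q(3) by (simp add: 3 l_def r_def algebra_simps)
      ultimately show ?thesis using 3 by metis
    qed
  qed
  then show ?thesis by (metis leading_coeff_0_iff zero_neq_one)
qed

text \<open>Otherwise the combination is a polynomial with infinitely many zeros, yet its
  coefficient at the largest degree that occurs is nonzero.\<close>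

lemma sum_BI_poly_eq_0:
  assumes "finite T" "infinite X"
    and zero: "\<And>x. x \<in> X \<Longrightarrow> (\<Sum>m\<in>T. d m * BI_poly m x \<rho>1 \<rho>2 r1 r2) = 0"
    and "m \<in> T"
  shows "d m = 0"
proof (rule ccontr)
  assume dm: "d m \<noteq> 0"
  obtain p where p: "\<And>m. degree (p m) = m" "\<And>m. p m \<noteq> 0" "\<And>m x. poly (p m) x = BI_poly m x \<rho>1 \<rho>2 r1 r2"
    using BI_poly_is_monic_poly[of _ \<rho>1 \<rho>2 r1 r2] by metis
  define S where "S = {m \<in> T. d m \<noteq> 0}"
  define M where "M = Max S"
  have S: "finite S" "S \<noteq> {}" using assms dm by (auto simp: S_def)
  then have M: "M \<in> S" "\<And>k. k \<in> S \<Longrightarrow> k \<le> M" by (simp_all add: M_def)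
  define q where "q = (\<Sum>m\<in>S. smult (d m) (p m))"
  have "poly q x = 0" if "x \<in> X" for x
  proof -
    have "poly q x = (\<Sum>m\<in>S. d m * BI_poly m x \<rho>1 \<rho>2 r1 r2)" by (simp add: q_def poly_sum p(3))
    also have "\<dots> = (\<Sum>m\<in>T. d m * BI_poly m x \<rho>1 \<rho>2 r1 r2)"
      using assms(1) by (intro sum.mono_neutral_left) (auto simp: S_def)
    finally show ?thesis using zero[OF that] by simp
  qed
  then have "X \<subseteq> {x. poly q x = 0}" by auto
  then have "q = 0" using assms(2) poly_roots_finite[of q] finite_subset by blast
  moreover have "coeff q M = d M * coeff (p M) M"
  proof -
    have "coeff q M = (\<Sum>m\<in>S. d m * coeff (p m) M)" by (simp add: q_def coeff_sum)
    also have "\<dots> = (\<Sum>m\<in>{M}. d m * coeff (p m) M)"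
    proof (rule sum.mono_neutral_right)
      show "\<forall>i\<in>S - {M}. d i * coeff (p i) M = 0"
      proof
        fix i assume "i \<in> S - {M}"
        then have "i < M" using M(2)[of i] by auto
        then show "d i * coeff (p i) M = 0" using p(1)[of i] by (simp add: coeff_eq_0)
      qed
    qed (use S M in auto)
    finally show ?thesis by simp
  qed
  moreover have "coeff (p M) M \<noteq> 0" using p(1)[of M] p(2)[of M] by (metis leading_coeff_0_iff)
  ultimately show False using M(1) by (simp add: S_def)
qed

lemma BI_scale_neq_0:
  assumes "y > 0" "\<alpha> > 1"
  shows "BI_scale m y \<alpha> \<noteq> 0"
proof -
  have "2 * real l + y + \<alpha> + 1 > 0" "real l + \<alpha> + (if odd l then y else 0) > 0" for l
    using assms by (simp_all add: add_nonneg_pos)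
  then have "- 4 * (2 * real l + y + \<alpha> + 1) / (real l + \<alpha> + (if odd l then y else 0)) \<noteq> 0" for l
    unfolding divide_eq_0_iff mult_eq_0_iff by (metis less_irrefl neg_equal_0_iff_equal zero_neq_numeral)
  then show ?thesis unfolding BI_scale_def prod_zero_iff[OF finite_lessThan] by blast
qed

section \<open>Independence of the multivariate polynomials\<close>

context BI_parameters
begin

text \<open>Varying only \<open>x p\<close> leaves \<open>node x (p + 1)\<close> fixed, so all
  parameters of the polynomials stay constant while the argument takes infinitely many
  values.\<close>

lemma sum_factor_eq_0:
  assumes p: "1 \<le> p" "p \<le> s" and "finite T"
    and zero: "\<And>z. (\<Sum>m\<in>T. d m * factor (x(p := z)) p (int m) (int M)) = 0"
    and "m \<in> T"
  shows "d m = 0"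
proof -
  define B where "B = base p (real M)"
  define pt where "pt z = par (int M) * (par z * (real_of_int z + asum \<alpha> 1 p / 2)) / 2 - 1 / 4" for z :: int
  have B: "B > 0" using base_pos[of p "real M"] p by (simp add: B_def)
  \<comment> \<open>On even integers the sign \<open>par z\<close> is 1, so \<open>pt\<close> is
    affine there.\<close>
  have inj: "inj_on pt (range (\<lambda>k. 2 * k))"
    by (auto simp: inj_on_def pt_def par_def split: if_splits)
  have infinite: "infinite (range pt)"
  proof -
    have "infinite (range (\<lambda>k::int. 2 * k))"
      by (simp add: finite_image_iff inj_on_def)
    then have "infinite (pt ` range (\<lambda>k. 2 * k))" using inj by (simp add: finite_image_iff)
    then show ?thesis by (meson finite_subset image_mono subset_UNIV)
  qed
  have "d m * (par (int M) ^ m * BI_scale m B (\<alpha> (p + 1))) = 0"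
  proof (rule sum_BI_poly_eq_0[OF assms(3) infinite _ assms(5), where d = "\<lambda>m. d m * (par (int M) ^ m * BI_scale m B (\<alpha> (p + 1)))"])
    fix z assume "z \<in> range pt"
    then obtain k where z: "z = pt k" by auto
    have node: "node (x(p := k)) p = par k * (real_of_int k + asum \<alpha> 1 p / 2)"
        "node (x(p := k)) (p + 1) = node x (p + 1)"
      using p by (simp_all add: node_def)
    show "(\<Sum>m\<in>T. d m * (par (int M) ^ m * BI_scale m B (\<alpha> (p + 1)))
      * BI_poly m z ((B - (\<beta> - \<alpha> 1 + 1)) / 4) (par (int M) * node x (p + 1) / 2 + (\<alpha> (p + 1) - 1) / 4)
        (par (int M) * node x (p + 1) / 2 - (\<alpha> (p + 1) - 1) / 4) (- (B + (\<beta> - \<alpha> 1 + 1)) / 4)) = 0"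
      using zero[of k] unfolding factor_def node BI_int_def BI_fun_def B_def z pt_def
      by (simp add: mult_ac)
  qed
  then show ?thesis
    using BI_scale_neq_0[OF B, of "\<alpha> (p + 1)" m] \<alpha>[of "p + 1"] p by (simp add: par_def split: if_splits)
qed

text \<open>Downward induction from the empty product. The factors above \<open>k\<close> do not
  involve \<open>x k\<close>, so the sum is grouped by the value of \<open>n k\<close> and
  univariate independence applies. Agreement outside \<open>{k..s}\<close> makes
  \<open>nsum n (k - 1)\<close> common to all of \<open>S\<close>.\<close>

lemma factors_independent:
  assumes "k \<le> s + 1" "1 \<le> k" "finite S" "\<And>n n' i. n \<in> S \<Longrightarrow> n' \<in> S \<Longrightarrow> i \<notin> {k..s} \<Longrightarrow> n i = n' i"
    and "\<And>x. (\<Sum>n\<in>S. c n * (\<Prod>p = k..s. factor x p (int (n p)) (int (nsum n (p - 1))))) = 0"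
    and "n \<in> S"
  shows "c n = 0"
  using assms
proof (induction k arbitrary: S n rule: inc_induct)
  case base
  have "S = {n}"
    using base.prems(3)[OF base.prems(5)] base.prems(5) by (auto simp: fun_eq_iff)
  then show ?case using base.prems(4) by simp
next
  case (step k)
  have k: "1 \<le> k" "k \<le> s" using step by auto
  define M where "M = nsum n (k - 1)"
  have M: "nsum m (k - 1) = M" if "m \<in> S" for m
    unfolding M_def nsum_def
  proof (rule sum.cong[OF refl])
    fix i assume "i \<in> {1..k - 1}"
    then have "i \<notin> {k..s}" using k by auto
    then show "m i = n i" by (rule step.prems(3)[OF that step.prems(5)])
  qed
  define S' where "S' = {m \<in> S. m k = n k}"
  define R where "R x m = c m * (\<Prod>p = Suc k..s. factor x p (int (m p)) (int (nsum m (p - 1))))" for x m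
  have inner: "(\<Sum>m\<in>{m \<in> S. m k = j}. R x m) = 0" if "j \<in> (\<lambda>m. m k) ` S" for j x
  proof (rule sum_factor_eq_0[OF k _ _ that, where d = "\<lambda>j. \<Sum>m\<in>{m \<in> S. m k = j}. R x m" and x = x and M = M])
    show "finite ((\<lambda>m. m k) ` S)" using step.prems(2) by simp
    fix z
    have R: "R (x(k := z)) m = R x m" for m
    proof -
      have "factor (x(k := z)) p = factor x p" if "p > k" for p
        using that by (simp add: fun_eq_iff factor_def node_def)
      then show ?thesis by (simp add: R_def)
    qed
    have "(\<Sum>j\<in>(\<lambda>m. m k) ` S. (\<Sum>m\<in>{m \<in> S. m k = j}. R x m) * factor (x(k := z)) k (int j) (int M))
      = (\<Sum>j\<in>(\<lambda>m. m k) ` S. \<Sum>m\<in>{m \<in> S. m k = j}. R x m * factor (x(k := z)) k (int (m k)) (int M))"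
      unfolding sum_distrib_right by (intro sum.cong) auto
    also have "\<dots> = (\<Sum>m\<in>S. R x m * factor (x(k := z)) k (int (m k)) (int M))"
      using step.prems(2) by (intro sum.group) auto
    also have "\<dots> = (\<Sum>m\<in>S. c m * (\<Prod>p = k..s. factor (x(k := z)) p (int (m p)) (int (nsum m (p - 1)))))"
      using k by (intro sum.cong[OF refl])
        (simp add: prod.atLeast_Suc_atMost[of k s] M[unfolded One_nat_def] R[symmetric] R_def[of "x(k := z)"])
    finally show "(\<Sum>j\<in>(\<lambda>m. m k) ` S. (\<Sum>m\<in>{m \<in> S. m k = j}. R x m) * factor (x(k := z)) k (int j) (int M)) = 0"
      using step.prems(4) by simp
  qed
  show ?case
  proof (rule step.IH[of S' n])
    fix m m' i assume *: "m \<in> S'" "m' \<in> S'" "i \<notin> {Suc k..s}"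
    show "m i = m' i"
    proof (cases "i = k")
      case True
      then show ?thesis using * by (simp add: S'_def)
    next
      case False
      then show ?thesis using * step.prems(3)[of m m' i] by (auto simp: S'_def)
    qed
  qed (use step.prems(2,5) inner[of "n k"] in \<open>auto simp: S'_def R_def\<close>)
qed

lemma renorm_BI_independent:
  assumes "finite S" "\<And>n n' i. n \<in> S \<Longrightarrow> n' \<in> S \<Longrightarrow> i \<notin> {1..s} \<Longrightarrow> n i = n' i"
    and zero: "\<And>x. (\<Sum>n\<in>S. c n * renorm_BI s \<alpha> \<beta> N n x) = 0"
    and "n \<in> S"
  shows "c n = 0"
proof -
  have "c n * gauge (nsum n s) = 0"
    using factors_independent[of 1 S "\<lambda>n. c n * gauge (nsum n s)" n] assms
    by (simp add: renorm_BI_eq mult.assoc)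
  then show ?thesis using gauge_neq_0 by simp
qed

end

section \<open>Finitely supported functionals and commutation\<close>

text \<open>The commutator at \<open>n\<close> is of this kind. Multi-indices are functions on all
  of \<open>nat\<close>; the agreement outside \<open>{1..s}\<close> keeps the support within a set
  to which independence applies.\<close>

definition local_functional :: "nat \<Rightarrow> (nat \<Rightarrow> nat) \<Rightarrow> (((nat \<Rightarrow> nat) \<Rightarrow> real) \<Rightarrow> real) \<Rightarrow> bool"
  where "local_functional s n \<phi> \<longleftrightarrow> (\<exists>S K. finite S \<and> (\<forall>m\<in>S. \<forall>i. i \<notin> {1..s} \<longrightarrow> m i = n i)
    \<and> (\<forall>f. \<phi> f = (\<Sum>m\<in>S. K m * f m)))"

lemma local_functional_zero: "local_functional s n (\<lambda>f. 0)"
  unfolding local_functional_def by (intro exI[of _ "{}"]) simp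

lemma local_functional_eval:
  assumes "\<And>i. i \<notin> {1..s} \<Longrightarrow> m i = n i"
  shows "local_functional s n (\<lambda>f. f m)"
  unfolding local_functional_def by (intro exI[of _ "{m}"] exI[of _ "\<lambda>_. 1"]) (use assms in simp)

lemma local_functional_scale:
  assumes "local_functional s n \<phi>"
  shows "local_functional s n (\<lambda>f. c * \<phi> f)"
proof -
  obtain S K where "finite S" "\<forall>m\<in>S. \<forall>i. i \<notin> {1..s} \<longrightarrow> m i = n i" "\<forall>f. \<phi> f = (\<Sum>m\<in>S. K m * f m)"
    using assms unfolding local_functional_def by blast
  then show ?thesis
    unfolding local_functional_def
    by (intro exI[of _ S] exI[of _ "\<lambda>m. c * K m"]) (simp add: sum_distrib_left mult.assoc)
qed

lemma local_functional_add:
  assumes "local_functional s n \<phi>" "local_functional s n \<psi>"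
  shows "local_functional s n (\<lambda>f. \<phi> f + \<psi> f)"
proof -
  obtain S K where S: "finite S" "\<forall>m\<in>S. \<forall>i. i \<notin> {1..s} \<longrightarrow> m i = n i" "\<forall>f. \<phi> f = (\<Sum>m\<in>S. K m * f m)"
    using assms(1) unfolding local_functional_def by blast
  obtain T L where T: "finite T" "\<forall>m\<in>T. \<forall>i. i \<notin> {1..s} \<longrightarrow> m i = n i" "\<forall>f. \<psi> f = (\<Sum>m\<in>T. L m * f m)"
    using assms(2) unfolding local_functional_def by blast
  have "\<phi> f + \<psi> f = (\<Sum>m\<in>S \<union> T. ((if m \<in> S then K m else 0) + (if m \<in> T then L m else 0)) * f m)" for f
  proof -
    have "(\<Sum>m\<in>S. K m * f m) = (\<Sum>m\<in>S \<union> T. (if m \<in> S then K m else 0) * f m)"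
      using S(1) T(1) by (intro sum.mono_neutral_cong_left) auto
    moreover have "(\<Sum>m\<in>T. L m * f m) = (\<Sum>m\<in>S \<union> T. (if m \<in> T then L m else 0) * f m)"
      using S(1) T(1) by (intro sum.mono_neutral_cong_left) auto
    ultimately show ?thesis using S(3) T(3) by (simp add: sum.distrib distrib_right)
  qed
  then show ?thesis
    unfolding local_functional_def using S(1,2) T(1,2)
    by (intro exI[of _ "S \<union> T"] exI[of _ "\<lambda>m. (if m \<in> S then K m else 0) + (if m \<in> T then L m else 0)"]) auto
qed

lemma local_functional_sum:
  assumes "finite A" "\<And>a. a \<in> A \<Longrightarrow> local_functional s n (\<phi> a)"
  shows "local_functional s n (\<lambda>f. \<Sum>a\<in>A. \<phi> a f)"
  using assms by (induction A) (simp_all add: local_functional_zero local_functional_add)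

lemma local_functional_trans:
  assumes "local_functional s m \<phi>" "\<And>i. i \<notin> {1..s} \<Longrightarrow> m i = n i"
  shows "local_functional s n \<phi>"
  using assms unfolding local_functional_def by metis

lemma local_functional_comp:
  assumes "local_functional s n \<phi>" "\<And>m. local_functional s m (\<lambda>f. L f m)"
  shows "local_functional s n (\<lambda>f. \<phi> (L f))"
proof -
  obtain S K where S: "finite S" "\<forall>m\<in>S. \<forall>i. i \<notin> {1..s} \<longrightarrow> m i = n i" "\<forall>f. \<phi> f = (\<Sum>m\<in>S. K m * f m)"
    using assms(1) unfolding local_functional_def by blast
  have "local_functional s n (\<lambda>f. \<Sum>m\<in>S. K m * L f m)"
    using S(1,2) by (intro local_functional_sum local_functional_scale local_functional_trans[OF assms(2)]) auto
  then show ?thesis using S(3) by simp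
qed

lemma local_functional_homogeneous:
  assumes "local_functional s n \<phi>"
  shows "\<phi> (\<lambda>m. c * f m) = c * \<phi> f"
  using assms unfolding local_functional_def by (auto simp: sum_distrib_left mult_ac)

lemma local_functional_BI_op: "local_functional s n (\<lambda>f. BI_op s \<alpha> \<beta> N j f n)"
proof -
  have shift: "local_functional s n (\<lambda>f. shift_op s j \<nu> f n)" for \<nu>
  proof (cases "\<forall>i. 0 \<le> shifted_index s j \<nu> n i")
    case True
    have "local_functional s n (\<lambda>f. f (\<lambda>i. nat (shifted_index s j \<nu> n i)))"
      by (rule local_functional_eval) (auto simp: shifted_index_def)
    then show ?thesis using True by (simp add: shift_op_def)
  next
    case False
    then have "shift_op s j \<nu> f n = 0" for f unfolding shift_op_def by (simp only: if_False)
    then show ?thesis by (simp add: local_functional_zero)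
  qed
  show ?thesis
    unfolding BI_op_def
    by (intro local_functional_add local_functional_sum local_functional_scale shift finite_step_vectors
        local_functional_eval) simp
qed

theorem proposition11:
  fixes s N :: nat and \<alpha> :: "nat \<Rightarrow> real" and \<beta> :: real
  assumes "s \<ge> 1"
    and "\<alpha> 1 - 1 > \<beta>" and "\<beta> > 0"
    and "\<And>i. 2 \<le> i \<Longrightarrow> i \<le> s + 1 \<Longrightarrow> \<alpha> i > 1"
  shows "(\<forall>i\<in>{1..s}. \<forall>j\<in>{1..s}.
            BI_op s \<alpha> \<beta> N i \<circ> BI_op s \<alpha> \<beta> N j = BI_op s \<alpha> \<beta> N j \<circ> BI_op s \<alpha> \<beta> N i)
       \<and> (\<forall>(n :: nat \<Rightarrow> nat) (x :: nat \<Rightarrow> int). \<forall>j\<in>{1..s}.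
            BI_op s \<alpha> \<beta> N j (\<lambda>m. renorm_BI s \<alpha> \<beta> N m x) n
              = BI_eigenvalue s \<alpha> N x j * renorm_BI s \<alpha> \<beta> N n x)"
proof -
  interpret BI_parameters s N \<alpha> \<beta>
    using assms by unfold_locales auto
  show ?thesis
  proof (intro conjI ballI allI)
    fix i j assume i: "i \<in> {1..s}" and j: "j \<in> {1..s}"
    let ?L = "BI_op s \<alpha> \<beta> N" and ?R = "\<lambda>x m. renorm_BI s \<alpha> \<beta> N m x"
    \<comment> \<open>On a common eigenfunction both orders give the product of the
      eigenvalues.\<close>
    have comp: "?L i (?L j (?R x)) n = BI_eigenvalue s \<alpha> N x j * (BI_eigenvalue s \<alpha> N x i * ?R x n)"
      if "i \<in> {1..s}" "j \<in> {1..s}" for i j x n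
    proof -
      have "?L j (?R x) = (\<lambda>m. BI_eigenvalue s \<alpha> N x j * ?R x m)" using BI_op_renorm_BI[OF that(2)] by (rule ext)
      then show ?thesis
        using local_functional_homogeneous[OF local_functional_BI_op] BI_op_renorm_BI[OF that(1)] by simp
    qed
    have "?L i (?L j f) n = ?L j (?L i f) n" for f n
    proof -
      have local: "local_functional s n (\<lambda>f. ?L i (?L j f) n)" for i j
        by (rule local_functional_comp[where \<phi> = "\<lambda>g. ?L i g n", OF local_functional_BI_op local_functional_BI_op])
      \<comment> \<open>The commutator at \<open>n\<close> is a finite combination of values
        \<open>f m\<close>. It vanishes on the renormalized polynomials for every \<open>x\<close>,
        so independence makes each coefficient 0 and it vanishes for every \<open>f\<close>.\<close>
      have "local_functional s n (\<lambda>f. ?L i (?L j f) n + (-1) * ?L j (?L i f) n)"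
        by (rule local_functional_add[OF local local_functional_scale[OF local]])
      then obtain S K where S: "finite S" "\<forall>m\<in>S. \<forall>i. i \<notin> {1..s} \<longrightarrow> m i = n i"
          "\<forall>f. ?L i (?L j f) n + (-1) * ?L j (?L i f) n = (\<Sum>m\<in>S. K m * f m)"
        unfolding local_functional_def by blast
      have agree: "m i = m' i" if "m \<in> S" "m' \<in> S" "i \<notin> {1..s}" for m m' i
        using S(2) that by metis
      have zero: "(\<Sum>m\<in>S. K m * ?R x m) = 0" for x
        unfolding S(3)[rule_format, of "?R x", symmetric] comp[OF i j] comp[OF j i] by simp
      have "K m = 0" if "m \<in> S" for m
        using renorm_BI_independent[of S K m] S(1) agree zero that by blast
      then have "(\<Sum>m\<in>S. K m * f m) = 0" by simp
      then show ?thesis using S(3)[rule_format, of f] by simp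
    qed
    then show "?L i \<circ> ?L j = ?L j \<circ> ?L i" by (simp add: fun_eq_iff)
  next
    fix n x j assume "j \<in> {1..s}"
    then show "BI_op s \<alpha> \<beta> N j (\<lambda>m. renorm_BI s \<alpha> \<beta> N m x) n
                = BI_eigenvalue s \<alpha> N x j * renorm_BI s \<alpha> \<beta> N n x"
      by (rule BI_op_renorm_BI)
  qed
qed

end
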